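(* Let $\mathbb{S}$ be a (two-dimensional) surface in $B(0,1/2)\subset\mathbb{R}^3$, the ball of radius $1/2$ centered at the origin. Suppose that for a fixed $K$ the points $\{p_i, 1\le i\le N\}$ are quasi-uniform samples of $K\mathbb{S} = \{K\cdot p \mid p\in\mathbb{S}\}$, where $N$ is of order $K^2$. Then, for any prescribed accuracy $\epsilon$, the parallel directional fast multipole algorithm (described in the context) sends at most $O(K^2\log K) = O(N\log N)$ data in aggregate over all processes. The implied constant may depend on $\epsilon$, on $\mathbb{S}$ and on the constants in the sampling assumptions, but not on $K$, $N$, the number of processes or the partition.
   Context: Problem: given densities $f_i$ at the points $p_i\in\mathbb{R}^3$, $|p_i|\le K/2$, compute to accuracy $\epsilon$ the potentials $u_i=\sum_{j=1}^N G(p_i,p_j)f_j$, where $G(x,y)=e^{2\pi\iota|x-y|}/|x-y|$ is the Helmholtz kernel. Assume $K=2^{2L}$ with $L$ a positive integer. Sampling: $\mathbb{S}$ is a fixed two-dimensional manifold. Quasi-uniform means that the fill distance of $\{p_i\}$ in $K\mathbb{S}$ is at most a fixed constant times the minimal distance between distinct sample points. Octree: the root is the cube of width $K$ centered at the origin; level-$l$ boxes are cubes of width $K2^{-l}$ in a $2^l\times2^l\times2^l$ grid. $w(B)$ denotes the width of $B$. A box is nonempty if it contains some $p_i$; only nonempty boxes take part in the algorithm. A box with $w(B)\ge1$ (high-frequency regime) is subdivided into 8 children iff it is nonempty; a box with $w(B)<1$ (low-frequency regime) is subdivided iff it contains more than a fixed constant number of points. High-frequency interaction lists: for $B$ with center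 $c$ and $w(B)=w\ge1$, the near field $N^B$ is the set of boxes containing a point $x$ with $|x-c|\le 3w^2/4$. With $P$ the parent of $B$, the interaction list $I^B$ is $N^P\setminus N^B$, i.e. the set of nonempty boxes $A$ with $w(A)=w(B)$ whose parent is in $N^P$ and which are not in $N^B$. The far field of $B$ (complement of $N^B$) is partitioned into $O(w^2)$ wedges of spanning angle $O(1/w)$, called directions $\ell$ of $B$; each $A\in I^B$ is assigned to exactly one direction. For each box $A$ and direction $\ell$ there is a vector $f^{A,o,\ell}$ of outgoing directional equivalent densities whose length is bounded by a constant depending only on $\epsilon$. Low-frequency interaction lists: for $w(B)<1$ the kernel-independent fast multipole method is used; the interaction list $I^B$ is a set of boxes whose cardinality is bounded by an absolute constant, and each box $A$ has one vector $f^{A,o}$ of outgoing equivalent densities, whose length is bounded by a constant depending only on $\epsilon$. Partition: there are $p$ processes. A map $\mathcal{P}$ assigns a process in $\{0,\dots,p-1\}$ to each nonempty box of width $\sqrt{K}$, and every descendant $A$ of such a box $B$ gets $\mathcal{P}(A)=\mathcal{P}(B)$. Points and densities are initially distributed according to $\mathcal{P}$. Put $\mathcal{I}^B=\{A\in I^B : \mathcal{P}(A)\ne\mathcal{P}(B)\}$. Communication of the algorithm: (1) for every nonempty box $B$ with $1\le w(B)\le\sqrt{K}$ and every $A\in\mathcal{I}^B$, process $\mathcal{P}(A)$ sends $f^{A,o,\ell}$ to process $\mathcal{P}(B)$, where $\ell$ is the direction of $A$ whose wedge contains $B$ (used in the high-frequency multipole-to-local translations); (2) for every nonempty box $B$ with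 $w(B)<1$ and every $A\in\mathcal{I}^B$, process $\mathcal{P}(A)$ sends $f^{A,o}$ to process $\mathcal{P}(B)$ (used in the low-frequency multipole-to-local translations). All other translations are local to a process, and no computation is performed on boxes of width greater than $\sqrt{K}$. The data sent in aggregate is the total number of entries of all vectors sent in (1) and (2). *)

theory Defs
  imports "HOL-Analysis.Analysis"
begin

section \<open>Surfaces and quasi-uniform samples\<close>

definition C1_on :: "('a::real_normed_vector) set \<Rightarrow> ('a \<Rightarrow> 'b::real_normed_vector) \<Rightarrow> bool" where
  "C1_on U f \<longleftrightarrow>
     (\<exists>f' :: 'a \<Rightarrow> ('a \<Rightarrow>\<^sub>L 'b).
        (\<forall>x\<in>U. (f has_derivative blinfun_apply (f' x)) (at x)) \<and> continuous_on U f')"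

definition C1_diffeomorphism ::
    "(real^3) set \<Rightarrow> (real^3) set \<Rightarrow> (real^3 \<Rightarrow> real^3) \<Rightarrow> (real^3 \<Rightarrow> real^3) \<Rightarrow> bool" where
  "C1_diffeomorphism U V \<phi> \<psi> \<longleftrightarrow>
     open U \<and> open V \<and> homeomorphism U V \<phi> \<psi> \<and> C1_on U \<phi> \<and> C1_on V \<psi>"

text \<open>
  A compact embedded two-dimensional \<open>C\<^sup>1\<close> submanifold of \<open>\<real>\<^sup>3\<close>, possibly with boundary:
  near each of its points a \<open>C\<^sup>1\<close> diffeomorphism of the ambient space straightens it to a
  piece of a plane or of a closed half-plane.
\<close>
definition surface :: "(real^3) set \<Rightarrow> bool" where
  "surface S \<longleftrightarrow>
     compact S \<and>
     (\<forall>x\<in>S. \<exists>U V \<phi> \<psi>. x \<in> U \<and> C1_diffeomorphism U V \<phi> \<psi> \<and>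
        (\<phi> ` (S \<inter> U) = V \<inter> {z. z $ 3 = 0} \<or>
         \<phi> ` (S \<inter> U) = V \<inter> {z. z $ 3 = 0 \<and> z $ 1 \<ge> 0}))"

definition fill_distance :: "(real^3) set \<Rightarrow> (real^3) set \<Rightarrow> real" where
  "fill_distance P M = (SUP y\<in>M. infdist y P)"

definition quasi_uniform :: "real \<Rightarrow> (real^3) set \<Rightarrow> (real^3) set \<Rightarrow> bool" where
  "quasi_uniform c P M \<longleftrightarrow>
     finite P \<and> P \<noteq> {} \<and> P \<subseteq> M \<and>
     (\<forall>x\<in>P. \<forall>y\<in>P. x \<noteq> y \<longrightarrow> fill_distance P M \<le> c * dist x y)"


section \<open>The octree\<close>

text \<open>
  A box is a pair of its level and its index in the grid of that level; the root is the
  cube of width \<open>K\<close> centered at the origin.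
\<close>
type_synonym box = "nat \<times> (int^3)"

definition grid_box :: "box \<Rightarrow> bool" where
  "grid_box b \<longleftrightarrow> (\<forall>i. 0 \<le> snd b $ i \<and> snd b $ i < 2 ^ fst b)"

definition parent :: "box \<Rightarrow> box" where
  "parent b = (fst b - 1, \<chi> i. snd b $ i div 2)"

definition width :: "real \<Rightarrow> box \<Rightarrow> real" where
  "width K b = K / 2 ^ fst b"

definition center :: "real \<Rightarrow> box \<Rightarrow> real^3" where
  "center K b = (\<chi> i. - K / 2 + (of_int (snd b $ i) + 1 / 2) * width K b)"

definition cube :: "real \<Rightarrow> box \<Rightarrow> (real^3) set" where
  "cube K b = {x. \<forall>i. \<bar>x $ i - center K b $ i\<bar> \<le> width K b / 2}"

text \<open>
  Ownership of points is decided by the half-open cube, with the outer faces of the root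
  included, so that every point of the root cube belongs to exactly one box of each level.
  The closed cube is used for distances, which makes the near-field relation symmetric.
\<close>
definition cell :: "real \<Rightarrow> box \<Rightarrow> (real^3) set" where
  "cell K b = {x. \<forall>i.
     center K b $ i - width K b / 2 \<le> x $ i \<and>
     (x $ i < center K b $ i + width K b / 2 \<or>
      x $ i = center K b $ i + width K b / 2 \<and> x $ i = K / 2)}"

definition subdivided :: "real \<Rightarrow> nat \<Rightarrow> (real^3) set \<Rightarrow> box \<Rightarrow> bool" where
  "subdivided K q P b \<longleftrightarrow>
     (if width K b \<ge> 1 then cell K b \<inter> P \<noteq> {} else card (cell K b \<inter> P) > q)"

inductive_set octree :: "real \<Rightarrow> nat \<Rightarrow> (real^3) set \<Rightarrow> box set"
  for K :: real and q :: nat and P :: "(real^3) set" where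
  root: "(0, 0) \<in> octree K q P"
| child: "b \<in> octree K q P \<Longrightarrow> subdivided K q P b \<Longrightarrow> fst a = Suc (fst b) \<Longrightarrow> parent a = b
    \<Longrightarrow> a \<in> octree K q P"

definition nonempty_boxes :: "real \<Rightarrow> nat \<Rightarrow> (real^3) set \<Rightarrow> box set" where
  "nonempty_boxes K q P = {b \<in> octree K q P. cell K b \<inter> P \<noteq> {}}"

text \<open>The nonempty boxes \<open>B\<close> with \<open>1 \<le> w(B) \<le> \<surd>K\<close>, and those with \<open>w(B) < 1\<close>.\<close>
definition high_boxes :: "real \<Rightarrow> nat \<Rightarrow> (real^3) set \<Rightarrow> box set" where
  "high_boxes K q P = {b \<in> nonempty_boxes K q P. 1 \<le> width K b \<and> width K b \<le> sqrt K}"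

definition low_boxes :: "real \<Rightarrow> nat \<Rightarrow> (real^3) set \<Rightarrow> box set" where
  "low_boxes K q P = {b \<in> nonempty_boxes K q P. width K b < 1}"


section \<open>Interaction lists and directions\<close>

definition near_field :: "real \<Rightarrow> box \<Rightarrow> box set" where
  "near_field K b = {a. grid_box a \<and> fst a = fst b \<and>
     (\<exists>x\<in>cube K a. norm (x - center K b) \<le> 3 * (width K b)\<^sup>2 / 4)}"

definition far_field :: "real \<Rightarrow> box \<Rightarrow> (real^3) set" where
  "far_field K b = - (\<Union>a\<in>near_field K b. cube K a)"

definition high_list :: "real \<Rightarrow> nat \<Rightarrow> (real^3) set \<Rightarrow> box \<Rightarrow> box set" where
  "high_list K q P b = {a \<in> nonempty_boxes K q P. width K a = width K b \<and>
     parent a \<in> near_field K (parent b) \<and> a \<notin> near_field K b}"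

definition angle :: "real^3 \<Rightarrow> real^3 \<Rightarrow> real" where
  "angle u v = arccos (u \<bullet> v / (norm u * norm v))"

text \<open>
  The wedges \<open>W d\<close>, \<open>d \<in> I\<close>, are cones with apex at the center of the box, cut off by its
  near field; \<open>cdir\<close> and \<open>cang\<close> are the constants in \<open>O(w\<^sup>2)\<close> and \<open>O(1/w)\<close>.
\<close>
definition wedge_partition ::
    "real \<Rightarrow> real \<Rightarrow> real \<Rightarrow> box \<Rightarrow> nat set \<Rightarrow> (nat \<Rightarrow> (real^3) set) \<Rightarrow> bool" where
  "wedge_partition cdir cang K b I W \<longleftrightarrow>
     finite I \<and> real (card I) \<le> cdir * (width K b)\<^sup>2 \<and>
     disjoint_family_on W I \<and> (\<Union>d\<in>I. W d) = far_field K b \<and>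
     (\<forall>d\<in>I. \<exists>T. cone T \<and> W d = far_field K b \<inter> (\<lambda>v. center K b + v) ` T) \<and>
     (\<forall>d\<in>I. \<forall>x\<in>W d. \<forall>y\<in>W d. angle (x - center K b) (y - center K b) \<le> cang / width K b)"

text \<open>
  \<open>dir a b\<close> is the direction of \<open>a\<close> to which \<open>b\<close> is assigned. Wedges partition points, not
  boxes, so the cube of \<open>b\<close> may straddle several wedges of \<open>a\<close>; it is assigned to one of
  those it meets (for instance the one containing its center). The near-field
  relation is symmetric, so \<open>b\<close> lies in the far field of \<open>a\<close> whenever \<open>a\<close> is in the
  interaction list of \<open>b\<close>.
\<close>
definition direction_assignment ::
    "real \<Rightarrow> nat \<Rightarrow> (real^3) set \<Rightarrow> (box \<Rightarrow> nat set) \<Rightarrow> (box \<Rightarrow> nat \<Rightarrow> (real^3) set)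
      \<Rightarrow> (box \<Rightarrow> box \<Rightarrow> nat) \<Rightarrow> bool" where
  "direction_assignment K q P dirs wedge dir \<longleftrightarrow>
     (\<forall>b\<in>high_boxes K q P. \<forall>a\<in>high_list K q P b.
        dir a b \<in> dirs a \<and> cube K b \<inter> wedge a (dir a b) \<noteq> {})"

definition low_interaction_lists ::
    "nat \<Rightarrow> real \<Rightarrow> nat \<Rightarrow> (real^3) set \<Rightarrow> (box \<Rightarrow> box set) \<Rightarrow> bool" where
  "low_interaction_lists m K q P low_list \<longleftrightarrow>
     (\<forall>b\<in>low_boxes K q P.
        low_list b \<subseteq> low_boxes K q P \<and> finite (low_list b) \<and> card (low_list b) \<le> m)"


section \<open>Partition and communication\<close>

text \<open>
  \<open>proc\<close> is arbitrary on the nonempty boxes of width \<open>\<surd>K\<close>, and every smaller box inherits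
  the process of its parent. Boxes wider than \<open>\<surd>K\<close> are not constrained.
\<close>
definition process_map ::
    "real \<Rightarrow> nat \<Rightarrow> (real^3) set \<Rightarrow> nat \<Rightarrow> (box \<Rightarrow> nat) \<Rightarrow> bool" where
  "process_map K q P np proc \<longleftrightarrow>
     (\<forall>b\<in>nonempty_boxes K q P. width K b = sqrt K \<longrightarrow> proc b < np) \<and>
     (\<forall>b\<in>nonempty_boxes K q P. width K b < sqrt K \<longrightarrow> proc b = proc (parent b))"

text \<open>A pair \<open>(b, a)\<close> stands for the vector sent from process \<open>proc a\<close> to process \<open>proc b\<close>.\<close>
definition high_messages ::
    "real \<Rightarrow> nat \<Rightarrow> (real^3) set \<Rightarrow> (box \<Rightarrow> nat) \<Rightarrow> (box \<times> box) set" where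
  "high_messages K q P proc =
     {(b, a). b \<in> high_boxes K q P \<and> a \<in> high_list K q P b \<and> proc a \<noteq> proc b}"

definition low_messages ::
    "real \<Rightarrow> nat \<Rightarrow> (real^3) set \<Rightarrow> (box \<Rightarrow> nat) \<Rightarrow> (box \<Rightarrow> box set) \<Rightarrow> (box \<times> box) set" where
  "low_messages K q P proc low_list =
     {(b, a). b \<in> low_boxes K q P \<and> a \<in> low_list b \<and> proc a \<noteq> proc b}"

text \<open>
  \<open>f_high a d\<close> and \<open>f_low a\<close> are the vectors of outgoing (directional) equivalent densities.
\<close>
definition data_sent ::
    "real \<Rightarrow> nat \<Rightarrow> (real^3) set \<Rightarrow> (box \<Rightarrow> nat) \<Rightarrow> (box \<Rightarrow> box \<Rightarrow> nat) \<Rightarrow> (box \<Rightarrow> box set)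
      \<Rightarrow> (box \<Rightarrow> nat \<Rightarrow> complex list) \<Rightarrow> (box \<Rightarrow> complex list) \<Rightarrow> nat" where
  "data_sent K q P proc dir low_list f_high f_low =
     (\<Sum>(b, a)\<in>high_messages K q P proc. length (f_high a (dir a b))) +
     (\<Sum>(b, a)\<in>low_messages K q P proc low_list. length (f_low a))"

definition densities_bounded ::
    "nat \<Rightarrow> real \<Rightarrow> nat \<Rightarrow> (real^3) set \<Rightarrow> (box \<Rightarrow> nat set)
      \<Rightarrow> (box \<Rightarrow> nat \<Rightarrow> complex list) \<Rightarrow> (box \<Rightarrow> complex list) \<Rightarrow> bool" where
  "densities_bounded n K q P dirs f_high f_low \<longleftrightarrow>
     (\<forall>a\<in>high_boxes K q P. \<forall>d\<in>dirs a. length (f_high a d) \<le> n) \<and>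
     (\<forall>a\<in>low_boxes K q P. length (f_low a) \<le> n)"

end

theory Submission
  imports Defs
begin

text \<open>
  Sending stops at width \<open>\<surd>K\<close>, so only \<open>L + 1 = O(log K)\<close> high-frequency levels communicate. At
  a level of width \<open>w\<close> the sampled surface \<open>K S\<close>, being two-dimensional, meets \<open>O((K / w)\<^sup>2)\<close>
  boxes; the interaction list of a box lies within distance \<open>O(w\<^sup>2)\<close>, where the surface meets
  only \<open>O((w\<^sup>2 / w)\<^sup>2) = O(w\<^sup>2)\<close> boxes. The product is \<open>O(K\<^sup>2)\<close> independently of \<open>w\<close>, and summing
  over the levels gives \<open>O(K\<^sup>2 log K)\<close> pairs, whatever the partition is
  (\<open>card_high_pairs_le\<close>).

  The two-dimensionality of \<open>S\<close> enters through a covering number: \<open>S\<close> inside a ball of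
  radius \<open>R\<close> is covered by \<open>A (R / r)\<^sup>2\<close> sets of diameter at most \<open>r\<close>
  (\<open>surface_quadratic_covering\<close>), because compactness reduces \<open>S\<close> to finitely many pieces
  that are bi-Lipschitz to subsets of a plane. A scale-invariant constant \<open>A\<close> is essential:
  the same bound is used for all widths and, after dilation, for all \<open>K\<close>.

  In the low-frequency regime every box has boundedly many partners, so it is enough to count
  boxes: each level has \<open>O(N) = O(K\<^sup>2)\<close> nonempty ones, and the depth of the tree must be
  \<open>O(log K)\<close>. The depth is controlled by the minimal distance of the samples. A
  nontrivial connected piece of \<open>K S\<close> has diameter of order \<open>K\<close>, and \<open>N\<close> balls cannot cover
  it unless their radius is of order \<open>K / N\<close>; hence the fill distance, and by
  quasi-uniformity the minimal distance, is at least of order \<open>K / N\<close>, that is \<open>1 / K\<close>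
  (\<open>point_separation\<close>). This one-dimensional estimate loses a factor \<open>K\<close>
  against the true order \<open>1\<close>, which only costs the harmless logarithm in the depth.

  Passing from \<open>K\<^sup>2 ln K\<close> to \<open>N ln N\<close> uses \<open>N \<ge> c\<^sub>1 K\<^sup>2\<close> and works for \<open>N \<ge> 2\<close>. For \<open>N = 1\<close> the
  bound is \<open>0\<close>, and indeed nothing is sent: the only box of width \<open>\<surd>K\<close> passes its
  process on to all smaller ones.
\<close>

section \<open>Covering numbers of surfaces\<close>

text \<open>
  By continuity the derivative is bounded near \<open>x\<close>; the mean value inequality applies on a ball,
  which is convex.
\<close>
lemma C1_on_locally_lipschitz:
  assumes "C1_on U f" "open U" "x \<in> U"
  shows "\<exists>\<rho>>0. \<exists>\<Lambda>. ball x \<rho> \<subseteq> U \<and> \<Lambda>-lipschitz_on (ball x \<rho>) f"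
proof -
  obtain f' where f': "\<And>x. x \<in> U \<Longrightarrow> (f has_derivative blinfun_apply (f' x)) (at x)"
    and cont: "continuous_on U f'"
    using assms(1) unfolding C1_on_def by blast
  obtain \<rho>0 where \<rho>0: "\<rho>0 > 0" "ball x \<rho>0 \<subseteq> U"
    using assms(2,3) open_contains_ball by blast
  obtain \<rho>1 where \<rho>1: "\<rho>1 > 0" "\<And>y. y \<in> U \<Longrightarrow> dist y x < \<rho>1 \<Longrightarrow> dist (f' y) (f' x) < 1"
    using cont assms(3) unfolding continuous_on_iff by (metis zero_less_one)
  define \<rho> where "\<rho> = min \<rho>0 \<rho>1"
  have "(norm (f' x) + 1)-lipschitz_on (ball x \<rho>) f"
  proof (rule bounded_derivative_imp_lipschitz)
    fix y assume y: "y \<in> ball x \<rho>"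
    then have "y \<in> U" "dist y x < \<rho>1" using \<rho>0(2) by (auto simp: \<rho>_def dist_commute)
    then show "(f has_derivative blinfun_apply (f' y)) (at y within ball x \<rho>)"
      using f' has_derivative_at_withinI by blast
    have "norm (f' y) \<le> norm (f' x) + 1"
      using \<rho>1(2)[OF \<open>y \<in> U\<close> \<open>dist y x < \<rho>1\<close>] norm_triangle_sub[of "f' y" "f' x"]
      by (simp add: dist_norm)
    then show "onorm (blinfun_apply (f' y)) \<le> norm (f' x) + 1"
      by (simp add: norm_blinfun.rep_eq)
  qed auto
  moreover have "\<rho> > 0" "ball x \<rho> \<subseteq> U" using \<rho>0 \<rho>1 by (auto simp: \<rho>_def)
  ultimately show ?thesis by blast
qed

text \<open>
  A straightening diffeomorphism is Lipschitz near \<open>x\<close>, and so is its inverse near the image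
  of \<open>x\<close>; shrinking the ball keeps its image inside the domain where the inverse is
  controlled.
\<close>
lemma surface_bilipschitz_chart:
  assumes "surface S" "x \<in> S"
  shows "\<exists>\<rho>>0. \<exists>\<Lambda>\<ge>1. \<exists>\<phi>::real^3 \<Rightarrow> real^3. \<forall>a\<in>S \<inter> ball x \<rho>. \<phi> a $ 3 = 0 \<and>
    (\<forall>b\<in>S \<inter> ball x \<rho>. dist (\<phi> a) (\<phi> b) \<le> \<Lambda> * dist a b \<and> dist a b \<le> \<Lambda> * dist (\<phi> a) (\<phi> b))"
proof -
  obtain U V \<phi> \<psi> where xU: "x \<in> U" and diffeo: "C1_diffeomorphism U V \<phi> \<psi>"
    and flat: "\<phi> ` (S \<inter> U) = V \<inter> {z. z $ 3 = 0} \<or>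
         \<phi> ` (S \<inter> U) = V \<inter> {z. z $ 3 = 0 \<and> z $ 1 \<ge> 0}"
    using assms unfolding surface_def by meson
  have opn: "open U" "open V" and hom: "homeomorphism U V \<phi> \<psi>"
    and C1: "C1_on U \<phi>" "C1_on V \<psi>"
    using diffeo by (auto simp: C1_diffeomorphism_def)
  have \<phi>V: "\<phi> x \<in> V" using hom xU by (auto simp: homeomorphism_def)
  obtain \<rho>1 \<Lambda>1 where 1: "\<rho>1 > 0" "ball x \<rho>1 \<subseteq> U" "\<Lambda>1-lipschitz_on (ball x \<rho>1) \<phi>"
    using C1_on_locally_lipschitz[OF C1(1) opn(1) xU] by blast
  obtain \<rho>2 \<Lambda>2 where 2: "\<rho>2 > 0" "ball (\<phi> x) \<rho>2 \<subseteq> V" "\<Lambda>2-lipschitz_on (ball (\<phi> x) \<rho>2) \<psi>"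
    using C1_on_locally_lipschitz[OF C1(2) opn(2) \<phi>V] by blast
  have "continuous_on U \<phi>" using hom by (simp add: homeomorphism_def)
  then obtain \<rho>3 where 3: "\<rho>3 > 0" "\<And>y. y \<in> U \<Longrightarrow> dist y x < \<rho>3 \<Longrightarrow> dist (\<phi> y) (\<phi> x) < \<rho>2"
    using xU \<open>\<rho>2 > 0\<close> unfolding continuous_on_iff by metis
  define \<rho> where "\<rho> = min \<rho>1 \<rho>3"
  define \<Lambda> where "\<Lambda> = max 1 (max \<Lambda>1 \<Lambda>2)"
  have in_dom: "a \<in> ball x \<rho>1" "a \<in> U" "\<phi> a \<in> ball (\<phi> x) \<rho>2" "\<psi> (\<phi> a) = a" if "a \<in> ball x \<rho>" for a
  proof -
    show a: "a \<in> ball x \<rho>1" using that by (simp add: \<rho>_def)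
    then show U: "a \<in> U" using 1(2) by blast
    show "\<phi> a \<in> ball (\<phi> x) \<rho>2" using 3(2)[OF U] that by (simp add: \<rho>_def dist_commute)
    show "\<psi> (\<phi> a) = a" using hom U by (simp add: homeomorphism_def)
  qed
  have "\<phi> a $ 3 = 0" if "a \<in> S \<inter> ball x \<rho>" for a
    using that in_dom(2)[of a] flat by blast
  moreover have "dist (\<phi> a) (\<phi> b) \<le> \<Lambda> * dist a b \<and> dist a b \<le> \<Lambda> * dist (\<phi> a) (\<phi> b)"
    if a: "a \<in> ball x \<rho>" and b: "b \<in> ball x \<rho>" for a b
  proof
    have "dist (\<phi> a) (\<phi> b) \<le> \<Lambda>1 * dist a b"
      using lipschitz_onD[OF 1(3)] in_dom[OF a] in_dom[OF b] by blast
    also have "\<dots> \<le> \<Lambda> * dist a b" by (rule mult_right_mono) (auto simp: \<Lambda>_def)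
    finally show "dist (\<phi> a) (\<phi> b) \<le> \<Lambda> * dist a b" .
    have "dist a b \<le> \<Lambda>2 * dist (\<phi> a) (\<phi> b)"
      using lipschitz_onD[OF 2(3) in_dom(3)[OF a] in_dom(3)[OF b]] in_dom(4)[OF a] in_dom(4)[OF b]
      by simp
    also have "\<dots> \<le> \<Lambda> * dist (\<phi> a) (\<phi> b)" by (rule mult_right_mono) (auto simp: \<Lambda>_def)
    finally show "dist a b \<le> \<Lambda> * dist (\<phi> a) (\<phi> b)" .
  qed
  moreover have "\<rho> > 0" "\<Lambda> \<ge> 1" using 1(1) 3(1) by (auto simp: \<rho>_def \<Lambda>_def)
  ultimately show ?thesis by (intro exI[of _ \<rho>] conjI exI[of _ \<Lambda>] exI[of _ \<phi>]) auto
qed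

text \<open>
  This is Assouad's condition for dimension two: one constant serves all pairs of scales
  \<open>r \<le> R\<close>.
\<close>
definition quadratic_covering :: "real \<Rightarrow> 'a::metric_space set \<Rightarrow> bool" where
  "quadratic_covering A M \<longleftrightarrow> (\<forall>c R r. 0 < r \<and> r \<le> R \<longrightarrow>
     (\<exists>\<D>. finite \<D> \<and> real (card \<D>) \<le> A * (R / r)\<^sup>2 \<and> M \<inter> cball c R \<subseteq> \<Union>\<D> \<and>
        (\<forall>D\<in>\<D>. \<forall>x\<in>D. \<forall>y\<in>D. dist x y \<le> r)))"

lemma quadratic_coveringE:
  assumes "quadratic_covering A M" "0 < r" "r \<le> R"
  obtains \<D> where "finite \<D>" "real (card \<D>) \<le> A * (R / r)\<^sup>2" "M \<inter> cball c R \<subseteq> \<Union>\<D>"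
    "\<forall>D\<in>\<D>. \<forall>x\<in>D. \<forall>y\<in>D. dist x y \<le> r"
proof -
  note assms(1)[unfolded quadratic_covering_def, rule_format, OF conjI[OF assms(2,3)], of c]
  then show thesis by (elim exE conjE) (rule that)
qed

lemma norm_vec3_le: "norm (v::real^3) \<le> \<bar>v $ 1\<bar> + \<bar>v $ 2\<bar> + \<bar>v $ 3\<bar>"
  using norm_le_l1_cart[of v] by (simp add: sum_3)

lemma floor_eq_imp_diff_le:
  assumes "\<lfloor>(u - o') / s\<rfloor> = \<lfloor>(v - o') / s\<rfloor>" "(s::real) > 0"
  shows "\<bar>u - v\<bar> \<le> s"
proof -
  have "\<bar>(u - o') / s - (v - o') / s\<bar> \<le> 1" using assms(1) by linarith
  then have "\<bar>(u - v) / s\<bar> \<le> 1" by (simp add: diff_divide_distrib)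
  then show ?thesis using assms(2) by (simp add: abs_divide divide_le_eq)
qed

text \<open>
  Pull back the square grid of side \<open>r / (2 \<Lambda>)\<close> from the plane. Two points in one grid square
  are at distance at most \<open>r / \<Lambda>\<close> in the plane, hence at most \<open>r\<close> in \<open>T\<close>, while the image of a
  ball of radius \<open>R\<close> has diameter at most \<open>2 \<Lambda> R\<close> and meets \<open>O((\<Lambda>\<^sup>2 R / r)\<^sup>2)\<close> squares. The image
  of \<open>T\<close> may be any part of the plane, so half-plane pieces at the boundary of a surface are
  treated like interior ones.
\<close>
lemma quadratic_covering_chart:
  fixes \<phi> :: "'a::metric_space \<Rightarrow> real^3"
  assumes \<Lambda>: "\<Lambda> \<ge> 1" and planar: "\<And>a. a \<in> T \<Longrightarrow> \<phi> a $ 3 = 0"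
    and lip: "\<And>a b. a \<in> T \<Longrightarrow> b \<in> T \<Longrightarrow> dist (\<phi> a) (\<phi> b) \<le> \<Lambda> * dist a b"
    and lip': "\<And>a b. a \<in> T \<Longrightarrow> b \<in> T \<Longrightarrow> dist a b \<le> \<Lambda> * dist (\<phi> a) (\<phi> b)"
  shows "quadratic_covering ((11 * \<Lambda>\<^sup>2)\<^sup>2) T"
  unfolding quadratic_covering_def
proof (intro allI impI)
  fix c and R r :: real assume rR: "0 < r \<and> r \<le> R"
  show "\<exists>\<D>. finite \<D> \<and> real (card \<D>) \<le> (11 * \<Lambda>\<^sup>2)\<^sup>2 * (R / r)\<^sup>2 \<and> T \<inter> cball c R \<subseteq> \<Union>\<D> \<and>
        (\<forall>D\<in>\<D>. \<forall>x\<in>D. \<forall>y\<in>D. dist x y \<le> r)"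
  proof (cases "T \<inter> cball c R = {}")
    case True
    then show ?thesis by (intro exI[of _ "{}"]) auto
  next
    case False
    then obtain o' where o': "o' \<in> T" "o' \<in> cball c R" by blast
    define s where "s = r / (2 * \<Lambda>)"
    have s: "s > 0" using rR \<Lambda> by (simp add: s_def)
    \<comment> \<open>Grid squares are counted from the image of a point of the piece, so that only differences matter.\<close>
    define key where "key a i = \<lfloor>(\<phi> a $ i - \<phi> o' $ i) / s\<rfloor>" for a and i :: 3
    define n where "n = \<lfloor>4 * (\<Lambda>\<^sup>2 * (R / r))\<rfloor> + 1"
    define D where "D = (\<lambda>(i, j). {a \<in> T \<inter> cball c R. key a 1 = i \<and> key a 2 = j})"
    define \<D> where "\<D> = D ` ({-n..n} \<times> {-n..n})"
    have big: "1 \<le> \<Lambda>\<^sup>2 * (R / r)"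
    proof -
      have "1 * 1 \<le> \<Lambda>\<^sup>2 * (R / r)"
        using rR \<Lambda> by (intro mult_mono) (auto simp: one_le_power)
      then show ?thesis by simp
    qed
    then have n: "n \<ge> 0" unfolding n_def by simp
    have key: "key a i \<in> {-n..n}" if "a \<in> T" "a \<in> cball c R" for a i
    proof -
      have "\<bar>\<phi> a $ i - \<phi> o' $ i\<bar> \<le> dist (\<phi> a) (\<phi> o')"
        using component_le_norm_cart[of "\<phi> a - \<phi> o'" i] by (simp add: dist_norm)
      also have "\<dots> \<le> \<Lambda> * dist a o'" by (rule lip) (use that o' in auto)
      also have "\<dots> \<le> \<Lambda> * (2 * R)"
        using \<Lambda> that(2) o'(2) dist_triangle2[of a o' c]
        by (intro mult_left_mono) (auto simp: dist_commute)
      finally have "\<bar>(\<phi> a $ i - \<phi> o' $ i) / s\<bar> \<le> \<Lambda> * (2 * R) / s"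
        using s by (simp add: abs_divide divide_right_mono)
      also have "\<dots> = 4 * (\<Lambda>\<^sup>2 * (R / r))"
        using rR \<Lambda> by (simp add: s_def field_simps power2_eq_square)
      finally show ?thesis unfolding key_def n_def atLeastAtMost_iff by linarith
    qed
    have "card \<D> \<le> card ({-n..n} \<times> {-n..n})" unfolding \<D>_def by (rule card_image_le) auto
    also have "\<dots> = nat (2 * n + 1) * nat (2 * n + 1)" by (simp add: card_cartesian_product)
    finally have "real (card \<D>) \<le> real (nat (2 * n + 1) * nat (2 * n + 1))" by linarith
    also have "\<dots> = (of_int (2 * n + 1))\<^sup>2" using n by (simp add: power2_eq_square)
    also have "\<dots> \<le> (11 * \<Lambda>\<^sup>2 * (R / r))\<^sup>2"
    proof (rule power_mono)
      define X where "X = \<Lambda>\<^sup>2 * (R / r)"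
      have "of_int n \<le> 4 * X + 1"
        unfolding n_def X_def using of_int_floor_le[of "4 * (\<Lambda>\<^sup>2 * (R / r))"] by linarith
      then have "of_int (2 * n + 1) \<le> 11 * X" using big by (fold X_def) simp
      then show "of_int (2 * n + 1) \<le> 11 * \<Lambda>\<^sup>2 * (R / r)" by (simp add: X_def mult.assoc)
    qed (use n in simp)
    finally have "real (card \<D>) \<le> (11 * \<Lambda>\<^sup>2)\<^sup>2 * (R / r)\<^sup>2" by (simp only: power_mult_distrib)
    moreover have "T \<inter> cball c R \<subseteq> \<Union>\<D>"
      using key by (force simp: \<D>_def D_def)
    moreover have "dist x y \<le> r" if "E \<in> \<D>" "x \<in> E" "y \<in> E" for E x y
    proof -
      have xy: "x \<in> T" "y \<in> T" "key x 1 = key y 1" "key x 2 = key y 2"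
        using that by (auto simp: \<D>_def D_def)
      have "dist (\<phi> x) (\<phi> y) \<le> \<bar>\<phi> x $ 1 - \<phi> y $ 1\<bar> + \<bar>\<phi> x $ 2 - \<phi> y $ 2\<bar>"
        using norm_vec3_le[of "\<phi> x - \<phi> y"] planar xy(1,2) by (simp add: dist_norm)
      also have "\<dots> \<le> s + s"
        using xy(3,4) s unfolding key_def by (intro add_mono floor_eq_imp_diff_le) auto
      finally have "\<Lambda> * dist (\<phi> x) (\<phi> y) \<le> \<Lambda> * (s + s)" using \<Lambda> by (intro mult_left_mono) auto
      also have "\<dots> = r" using \<Lambda> by (simp add: s_def)
      finally show ?thesis using lip'[OF xy(1,2)] by linarith
    qed
    moreover have "finite \<D>" by (simp add: \<D>_def)
    ultimately show ?thesis by blast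
  qed
qed

lemma quadratic_covering_subset:
  assumes "quadratic_covering A M" "M' \<subseteq> M"
  shows "quadratic_covering A M'"
  using assms unfolding quadratic_covering_def by (meson Int_mono order_refl order_trans)

lemma quadratic_covering_Un:
  assumes "quadratic_covering A M" "quadratic_covering A' M'"
  shows "quadratic_covering (A + A') (M \<union> M')"
  unfolding quadratic_covering_def
proof (intro allI impI)
  fix c and R r :: real assume rR: "0 < r \<and> r \<le> R"
  obtain \<D> where 1: "finite \<D>" "real (card \<D>) \<le> A * (R / r)\<^sup>2" "M \<inter> cball c R \<subseteq> \<Union>\<D>"
    "\<forall>D\<in>\<D>. \<forall>x\<in>D. \<forall>y\<in>D. dist x y \<le> r"
    by (rule quadratic_coveringE[OF assms(1), where c = c]) (use rR in auto)
  obtain \<D>' where 2: "finite \<D>'" "real (card \<D>') \<le> A' * (R / r)\<^sup>2" "M' \<inter> cball c R \<subseteq> \<Union>\<D>'"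
    "\<forall>D\<in>\<D>'. \<forall>x\<in>D. \<forall>y\<in>D. dist x y \<le> r"
    by (rule quadratic_coveringE[OF assms(2), where c = c]) (use rR in auto)
  have "real (card (\<D> \<union> \<D>')) \<le> (A + A') * (R / r)\<^sup>2"
    using card_Un_le[of \<D> \<D>'] 1(2) 2(2) by (simp add: distrib_right)
  then show "\<exists>\<D>. finite \<D> \<and> real (card \<D>) \<le> (A + A') * (R / r)\<^sup>2 \<and> (M \<union> M') \<inter> cball c R \<subseteq> \<Union>\<D> \<and>
        (\<forall>D\<in>\<D>. \<forall>x\<in>D. \<forall>y\<in>D. dist x y \<le> r)"
    using 1 2 by (intro exI[of _ "\<D> \<union> \<D>'"]) auto
qed

lemma quadratic_covering_UN:
  assumes "finite I" "\<And>i. i \<in> I \<Longrightarrow> quadratic_covering (A i) (M i)"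
  shows "quadratic_covering (\<Sum>i\<in>I. A i) (\<Union>i\<in>I. M i)"
  using assms
proof (induction I rule: finite_induct)
  case empty
  show ?case unfolding quadratic_covering_def by (auto intro: exI[of _ "{}"])
qed (simp add: quadratic_covering_Un)

text \<open>
  A dilation changes neither the ratio \<open>R / r\<close> nor, therefore, the constant.
\<close>
lemma quadratic_covering_scaleR:
  fixes M :: "'a::real_normed_vector set"
  assumes "quadratic_covering A M" "K > 0"
  shows "quadratic_covering A ((\<lambda>x. K *\<^sub>R x) ` M)"
  unfolding quadratic_covering_def
proof (intro allI impI)
  fix c :: 'a and R r :: real assume rR: "0 < r \<and> r \<le> R"
  then have "0 < r / K" "r / K \<le> R / K" using assms(2) by (simp_all add: divide_right_mono)
  note cover = quadratic_coveringE[OF assms(1) this, of "c /\<^sub>R K"]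
  obtain \<D> where \<D>: "finite \<D>" "real (card \<D>) \<le> A * ((R / K) / (r / K))\<^sup>2"
    "M \<inter> cball (c /\<^sub>R K) (R / K) \<subseteq> \<Union>\<D>" "\<forall>D\<in>\<D>. \<forall>x\<in>D. \<forall>y\<in>D. dist x y \<le> r / K"
    by (rule cover)
  have scale: "dist (K *\<^sub>R x) (K *\<^sub>R y) = K * dist x y" for x y :: 'a
    using assms(2) by (simp add: dist_norm flip: scaleR_right_diff_distrib)
  let ?\<E> = "(\<lambda>D. (\<lambda>x. K *\<^sub>R x) ` D) ` \<D>"
  have "real (card ?\<E>) \<le> A * (R / r)\<^sup>2"
    using card_image_le[OF \<D>(1), of "\<lambda>D. (\<lambda>x. K *\<^sub>R x) ` D"] \<D>(2) assms(2) by simp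
  moreover have "(\<lambda>x. K *\<^sub>R x) ` M \<inter> cball c R \<subseteq> \<Union>?\<E>"
  proof
    fix y assume "y \<in> (\<lambda>x. K *\<^sub>R x) ` M \<inter> cball c R"
    then obtain x where x: "x \<in> M" "y = K *\<^sub>R x" "dist c y \<le> R" by auto
    have "K * dist (c /\<^sub>R K) x \<le> R" using x(2,3) scale[of "c /\<^sub>R K" x] assms(2) by simp
    then have "x \<in> M \<inter> cball (c /\<^sub>R K) (R / K)"
      using x(1) assms(2) by (simp add: pos_le_divide_eq mult.commute)
    then show "y \<in> \<Union>?\<E>" using \<D>(3) x(2) by blast
  qed
  moreover have "\<forall>D\<in>?\<E>. \<forall>x\<in>D. \<forall>y\<in>D. dist x y \<le> r"
    using \<D>(4) assms(2) by (auto simp: scale pos_le_divide_eq mult.commute)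
  ultimately show "\<exists>\<D>. finite \<D> \<and> real (card \<D>) \<le> A * (R / r)\<^sup>2 \<and>
      (\<lambda>x. K *\<^sub>R x) ` M \<inter> cball c R \<subseteq> \<Union>\<D> \<and> (\<forall>D\<in>\<D>. \<forall>x\<in>D. \<forall>y\<in>D. dist x y \<le> r)"
    using \<D>(1) by (intro exI[of _ ?\<E>]) auto
qed

lemma surface_quadratic_covering:
  assumes "surface S"
  shows "\<exists>A. quadratic_covering A S"
proof -
  have "\<exists>\<rho> A. \<rho> > 0 \<and> quadratic_covering A (S \<inter> ball x \<rho>)" if x: "x \<in> S" for x
  proof -
    obtain \<rho> \<Lambda> and \<phi> :: "real^3 \<Rightarrow> real^3" where "\<rho> > 0" "\<Lambda> \<ge> 1"
      and *: "\<forall>a\<in>S \<inter> ball x \<rho>. \<phi> a $ 3 = 0 \<and> (\<forall>b\<in>S \<inter> ball x \<rho>.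
        dist (\<phi> a) (\<phi> b) \<le> \<Lambda> * dist a b \<and> dist a b \<le> \<Lambda> * dist (\<phi> a) (\<phi> b))"
      using surface_bilipschitz_chart[OF assms x] by metis
    have "quadratic_covering ((11 * \<Lambda>\<^sup>2)\<^sup>2) (S \<inter> ball x \<rho>)"
      by (rule quadratic_covering_chart[OF \<open>\<Lambda> \<ge> 1\<close>]) (use * in blast)+
    then show ?thesis using \<open>\<rho> > 0\<close> by blast
  qed
  then obtain \<rho> A where \<rho>: "\<And>x. x \<in> S \<Longrightarrow> \<rho> x > 0"
    and A: "\<And>x. x \<in> S \<Longrightarrow> quadratic_covering (A x) (S \<inter> ball x (\<rho> x))"
    by metis
  have "compact S" using assms by (simp add: surface_def)
  moreover have "S \<subseteq> (\<Union>x\<in>S. ball x (\<rho> x))" using \<rho> by force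
  ultimately obtain F where F: "F \<subseteq> S" "finite F" "S \<subseteq> (\<Union>x\<in>F. ball x (\<rho> x))"
    using compactE_image[of S S "\<lambda>x. ball x (\<rho> x)"] by blast
  have "quadratic_covering (\<Sum>x\<in>F. A x) (\<Union>x\<in>F. S \<inter> ball x (\<rho> x))"
    using F A by (intro quadratic_covering_UN) auto
  then show ?thesis using F(3) by (blast intro: quadratic_covering_subset)
qed

section \<open>Separation of quasi-uniform samples\<close>

text \<open>
  In a chart, a short segment from the image of a point in the first coordinate
  direction stays in the plane, and in the half-plane as well, since it moves away from the
  boundary line.
\<close>
lemma surface_contains_nontrivial_connected:
  assumes "surface S" "S \<noteq> {}"
  shows "\<exists>T\<subseteq>S. \<exists>a\<in>T. \<exists>b\<in>T. connected T \<and> a \<noteq> b"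
proof -
  obtain x where x: "x \<in> S" using assms(2) by blast
  obtain U V \<phi> \<psi> where xU: "x \<in> U" and diffeo: "C1_diffeomorphism U V \<phi> \<psi>"
    and flat: "\<phi> ` (S \<inter> U) = V \<inter> {z. z $ 3 = 0} \<or>
         \<phi> ` (S \<inter> U) = V \<inter> {z. z $ 3 = 0 \<and> z $ 1 \<ge> 0}"
    using assms(1) x unfolding surface_def by meson
  have "open V" and hom: "homeomorphism U V \<phi> \<psi>"
    using diffeo by (auto simp: C1_diffeomorphism_def)
  define z where "z = \<phi> x"
  have z: "z \<in> \<phi> ` (S \<inter> U)" "z \<in> V" using x xU hom by (auto simp: z_def homeomorphism_def)
  obtain \<rho> where \<rho>: "\<rho> > 0" "ball z \<rho> \<subseteq> V" using \<open>open V\<close> z(2) open_contains_ball by blast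
  define z' where "z' = z + (\<rho> / 2) *\<^sub>R axis 1 1"
  have "dist z z' = \<rho> / 2" using \<rho>(1) by (simp add: z'_def dist_norm norm_axis_1)
  then have "z \<in> ball z \<rho>" "z' \<in> ball z \<rho>" "z \<noteq> z'" using \<rho>(1) by auto
  then have seg: "closed_segment z z' \<subseteq> V"
    using \<rho>(2) closed_segment_subset[OF _ _ convex_ball] by blast
  have same: "y $ 3 = z $ 3 \<and> y $ 1 \<ge> z $ 1" if y: "y \<in> closed_segment z z'" for y
  proof -
    obtain u where u: "0 \<le> u" "y = (1 - u) *\<^sub>R z + u *\<^sub>R z'"
      using y by (auto simp: in_segment)
    have "z' $ 3 = z $ 3" "z' $ 1 = z $ 1 + \<rho> / 2" by (simp_all add: z'_def axis_def)
    then have "y $ 3 = z $ 3" "y $ 1 = z $ 1 + u * (\<rho> / 2)"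
      unfolding u(2) by (simp_all add: left_diff_distrib distrib_left)
    then show ?thesis using u(1) \<rho>(1) by simp
  qed
  have img: "closed_segment z z' \<subseteq> \<phi> ` (S \<inter> U)"
  proof
    fix y assume y: "y \<in> closed_segment z z'"
    have "z $ 3 = 0" using flat z(1) by blast
    from flat show "y \<in> \<phi> ` (S \<inter> U)"
    proof
      assume eq: "\<phi> ` (S \<inter> U) = V \<inter> {z. z $ 3 = 0}"
      show ?thesis unfolding eq using y seg same \<open>z $ 3 = 0\<close> by auto
    next
      assume eq: "\<phi> ` (S \<inter> U) = V \<inter> {z. z $ 3 = 0 \<and> z $ 1 \<ge> 0}"
      then have "z $ 1 \<ge> 0" using z(1) by blast
      then show ?thesis unfolding eq using y seg same[OF y] \<open>z $ 3 = 0\<close> by auto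
    qed
  qed
  have "\<psi> ` closed_segment z z' \<subseteq> S"
  proof
    fix y assume "y \<in> \<psi> ` closed_segment z z'"
    then obtain s where "s \<in> S" "s \<in> U" "y = \<psi> (\<phi> s)" using img by blast
    then show "y \<in> S" using hom by (simp add: homeomorphism_def)
  qed
  moreover have "connected (\<psi> ` closed_segment z z')"
    using hom seg by (intro connected_continuous_image)
      (auto simp: homeomorphism_def intro: continuous_on_subset)
  moreover have "\<psi> z \<noteq> \<psi> z'"
    using hom seg \<open>z \<noteq> z'\<close> unfolding homeomorphism_def by (metis ends_in_segment subsetD)
  ultimately show ?thesis using ends_in_segment[of z z'] by blast
qed

text \<open>
  The distance from \<open>a\<close> takes every value between \<open>0\<close> and \<open>dist a b\<close> on \<open>T\<close>. Of \<open>n + 1\<close> equally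
  spaced values, where \<open>n = card P\<close>, two are taken in the same ball of radius \<open>h\<close>, so the spacing
  is at most \<open>2 h\<close>.
\<close>
lemma connected_covering_dist_le:
  fixes T :: "'a::metric_space set"
  assumes T: "connected T" "a \<in> T" "b \<in> T" and P: "finite P"
    and cov: "\<And>y. y \<in> T \<Longrightarrow> \<exists>p\<in>P. dist y p \<le> h"
  shows "dist a b \<le> 2 * h * card P"
proof -
  define n where "n = card P"
  have "P \<noteq> {}" using cov T(2) by blast
  then have n: "n > 0" using P by (simp add: n_def card_gt_0_iff)
  define t where "t j = real j / real n * dist a b" for j
  have "\<exists>y\<in>T. dist a y = t j" if "j \<le> n" for j
  proof -
    have "connected (dist a ` T)"
      using T(1) by (intro connected_continuous_image continuous_intros)
    moreover have "dist a a \<in> dist a ` T" "dist a b \<in> dist a ` T" using T by auto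
    moreover have "dist a a \<le> t j" by (simp add: t_def)
    moreover have "t j \<le> dist a b"
      using that n unfolding t_def by (intro mult_left_le_one_le) auto
    ultimately have "t j \<in> dist a ` T" by (metis connectedD_interval)
    then show ?thesis by force
  qed
  then obtain y where y: "\<And>j. j \<le> n \<Longrightarrow> y j \<in> T \<and> dist a (y j) = t j" by metis
  obtain p where p: "\<And>j. j \<le> n \<Longrightarrow> p j \<in> P \<and> dist (y j) (p j) \<le> h"
  proof -
    have "\<forall>j. \<exists>q. j \<le> n \<longrightarrow> q \<in> P \<and> dist (y j) q \<le> h" using cov y by blast
    then show ?thesis using that by metis
  qed
  have "card (p ` {..n}) \<le> n" unfolding n_def using p P by (intro card_mono) (auto simp: n_def)
  then have "\<not> inj_on p {..n}" by (intro pigeonhole) simp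
  then obtain i j where ij: "i \<le> n" "j \<le> n" "i < j" "p i = p j"
    unfolding inj_on_def by (metis atMost_iff linorder_neqE_nat)
  have "dist a b = real n * (1 / real n * dist a b)" using n by simp
  also have "\<dots> \<le> real n * (t j - t i)"
  proof (rule mult_left_mono)
    have "1 \<le> real j - real i" using ij(3) by linarith
    then have "1 / real n * dist a b \<le> (real j - real i) / real n * dist a b"
      by (intro mult_right_mono divide_right_mono) auto
    then show "1 / real n * dist a b \<le> t j - t i"
      by (simp add: t_def diff_divide_distrib left_diff_distrib)
  qed simp
  also have "\<dots> \<le> real n * (2 * h)"
  proof (rule mult_left_mono)
    have "t j - t i \<le> dist (y j) (y i)"
      using y[OF ij(1)] y[OF ij(2)] dist_triangle[of a "y j" "y i"] by (simp add: dist_commute)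
    also have "\<dots> \<le> 2 * h"
      using p[OF ij(1)] p[OF ij(2)] ij(4) dist_triangle2[of "y j" "y i" "p j"] by simp
    finally show "t j - t i \<le> 2 * h" .
  qed simp
  finally show ?thesis by (simp add: n_def mult.commute mult.left_commute)
qed

text \<open>
  Balls of radius the fill distance around the samples cover \<open>T\<close>, and the fill distance is at
  most \<open>c\<close> times the distance of any two distinct samples.
\<close>
lemma quasi_uniform_separation:
  assumes qu: "quasi_uniform c P M" and M: "bounded M"
    and T: "connected T" "T \<subseteq> M" "a \<in> T" "b \<in> T"
    and xy: "x \<in> P" "y \<in> P" "x \<noteq> y"
  shows "dist a b \<le> 2 * (c * dist x y) * card P"
proof -
  have P: "finite P" "P \<noteq> {}" "P \<subseteq> M" and sep: "fill_distance P M \<le> c * dist x y"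
    using qu xy by (auto simp: quasi_uniform_def)
  obtain e where e: "\<And>u v. u \<in> M \<Longrightarrow> v \<in> M \<Longrightarrow> dist u v \<le> e"
    using M unfolding bounded_two_points by auto
  have bdd: "bdd_above ((\<lambda>u. infdist u P) ` M)"
  proof (rule bdd_aboveI2)
    fix u assume "u \<in> M"
    then show "infdist u P \<le> e" using e infdist_le2[OF xy(1), of u e] P(3) xy(1) by blast
  qed
  have "dist a b \<le> 2 * fill_distance P M * card P"
  proof (rule connected_covering_dist_le[OF T(1,3,4) P(1)])
    fix u assume "u \<in> T"
    then have "infdist u P \<le> fill_distance P M"
      using T(2) bdd unfolding fill_distance_def by (intro cSUP_upper) auto
    moreover obtain p where "p \<in> P" "infdist u P = dist u p"
      using infdist_attains_inf[OF finite_imp_closed[OF P(1)] P(2)] by blast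
    ultimately show "\<exists>p\<in>P. dist u p \<le> fill_distance P M" by auto
  qed
  also have "\<dots> \<le> 2 * (c * dist x y) * card P" using sep by (intro mult_right_mono) auto
  finally show ?thesis .
qed

text \<open>
  The dilated piece of the surface has diameter at least \<open>K dist a b\<close>, and \<open>card P\<close> is at most
  of order \<open>K\<^sup>2\<close>, so the preceding bound gives a separation of order \<open>1 / K\<close>. The exponent \<open>n\<close>
  depends only on \<open>c\<close>, \<open>c2\<close> and the piece, so it serves all \<open>K\<close>.
\<close>
lemma point_separation:
  assumes K: "K > 0" and T: "T \<subseteq> S" "connected T" "a \<in> T" "b \<in> T" "a \<noteq> b" and S: "bounded S"
    and qu: "quasi_uniform c P ((\<lambda>x. K *\<^sub>R x) ` S)" and card: "real (card P) \<le> c2 * K\<^sup>2"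
    and n: "2 * max c 0 * max c2 0 / dist a b \<le> 2 ^ n"
    and xy: "x \<in> P" "y \<in> P" "x \<noteq> y"
  shows "1 \<le> 2 ^ n * K * dist x y"
proof -
  let ?s = "\<lambda>x. K *\<^sub>R x"
  have d: "dist a b > 0" using T(5) by simp
  have "dist (?s a) (?s b) \<le> 2 * (c * dist x y) * card P"
    by (rule quasi_uniform_separation[OF qu bounded_scaling[OF S], where T = "?s ` T"])
      (use T xy in \<open>auto intro!: connected_continuous_image continuous_intros\<close>)
  also have "dist (?s a) (?s b) = K * dist a b"
    using K by (simp add: dist_norm flip: scaleR_right_diff_distrib)
  also have "2 * (c * dist x y) * card P \<le> 2 * (max c 0 * dist x y) * (max c2 0 * K\<^sup>2)"
  proof (rule mult_mono)
    show "2 * (c * dist x y) \<le> 2 * (max c 0 * dist x y)" by (simp add: mult_right_mono)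
    have "c2 * K\<^sup>2 \<le> max c2 0 * K\<^sup>2" by (rule mult_right_mono) auto
    then show "real (card P) \<le> max c2 0 * K\<^sup>2" using card by linarith
  qed auto
  finally have "K * dist a b \<le> K * (2 * max c 0 * max c2 0 * (K * dist x y))"
    by (simp add: power2_eq_square algebra_simps)
  then have "dist a b \<le> 2 * max c 0 * max c2 0 * (K * dist x y)"
    using K by (simp only: mult_le_cancel_left_pos)
  then have "1 \<le> 2 * max c 0 * max c2 0 / dist a b * (K * dist x y)"
    using d by (simp add: field_simps)
  also have "\<dots> \<le> 2 ^ n * (K * dist x y)" using n K by (intro mult_right_mono) auto
  finally show ?thesis by (simp add: mult.assoc)
qed

section \<open>Geometry of the octree\<close>

lemma width_parent: "fst b > 0 \<Longrightarrow> width K (parent b) = 2 * width K b"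
  by (cases "fst b") (auto simp: width_def parent_def)

lemma index_parent: "snd (parent b) $ i = snd b $ i div 2"
  by (simp add: parent_def)

lemma center_nth: "center K b $ i = - K / 2 + (of_int (snd b $ i) + 1 / 2) * width K b"
  by (simp add: center_def)

lemma mem_cell_iff:
  "x \<in> cell K b \<longleftrightarrow> (\<forall>i. - K / 2 + of_int (snd b $ i) * width K b \<le> x $ i \<and>
     (x $ i < - K / 2 + (of_int (snd b $ i) + 1) * width K b \<or>
      x $ i = - K / 2 + (of_int (snd b $ i) + 1) * width K b \<and> x $ i = K / 2))"
proof -
  have "- K / 2 + (k + 1 / 2) * w - w / 2 = - K / 2 + k * w"
    "- K / 2 + (k + 1 / 2) * w + w / 2 = - K / 2 + (k + 1) * w" for k w :: real
    by (simp_all add: distrib_right)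
  then show ?thesis unfolding cell_def mem_Collect_eq center_nth by (simp only:)
qed

lemma mem_cube_iff:
  "x \<in> cube K b \<longleftrightarrow> (\<forall>i. - K / 2 + of_int (snd b $ i) * width K b \<le> x $ i \<and>
     x $ i \<le> - K / 2 + (of_int (snd b $ i) + 1) * width K b)"
proof -
  have "\<bar>t - (- K / 2 + (k + 1 / 2) * w)\<bar> \<le> w / 2 \<longleftrightarrow>
    - K / 2 + k * w \<le> t \<and> t \<le> - K / 2 + (k + 1) * w" for t k w :: real
    unfolding abs_le_iff by (auto simp: distrib_right)
  then show ?thesis unfolding cube_def mem_Collect_eq center_nth by simp
qed

lemma cell_subset_cube: "cell K b \<subseteq> cube K b"
proof
  fix x assume "x \<in> cell K b"
  then have "- K / 2 + of_int (snd b $ i) * width K b \<le> x $ i \<and>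
     x $ i \<le> - K / 2 + (of_int (snd b $ i) + 1) * width K b" for i
    unfolding mem_cell_iff by (metis order.refl less_imp_le)
  then show "x \<in> cube K b" unfolding mem_cube_iff by blast
qed

lemma dist_cube_le:
  assumes "x \<in> cube K b" "y \<in> cube K b"
  shows "dist x y \<le> 3 * width K b"
proof -
  have "\<bar>x $ i - y $ i\<bar> \<le> width K b" for i
    using assms[unfolded mem_cube_iff, rule_format, of i] by (auto simp: distrib_right)
  from this[of 1] this[of 2] this[of 3] show ?thesis
    using norm_vec3_le[of "x - y"] by (simp add: dist_norm)
qed

lemma parent_index_bounds:
  assumes "w \<ge> (0::real)"
  shows "of_int (k div 2) * (2 * w) \<le> of_int k * w"
    and "(of_int k + 1) * w \<le> (of_int (k div 2) + 1) * (2 * w)"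
proof -
  have "2 * (k div 2) \<le> k" "k + 1 \<le> 2 * (k div 2 + 1)" by presburger+
  then have "of_int (2 * (k div 2)) \<le> (of_int k :: real)"
    "of_int (k + 1) \<le> (of_int (2 * (k div 2 + 1)) :: real)" by (simp_all only: of_int_le_iff)
  from this[THEN mult_right_mono[OF _ assms]]
  show "of_int (k div 2) * (2 * w) \<le> of_int k * w"
    "(of_int k + 1) * w \<le> (of_int (k div 2) + 1) * (2 * w)" by (simp_all add: ac_simps)
qed

lemma cell_subset_parent_cell:
  assumes "fst b > 0" "K \<ge> 0"
  shows "cell K b \<subseteq> cell K (parent b)"
proof
  fix x assume "x \<in> cell K b"
  moreover have "width K b \<ge> 0" using assms by (simp add: width_def)
  ultimately show "x \<in> cell K (parent b)"
    unfolding mem_cell_iff width_parent[OF assms(1)] index_parent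
    using parent_index_bounds[of "width K b"] by (smt (verit))
qed

lemma cube_subset_parent_cube:
  assumes "fst b > 0" "K \<ge> 0"
  shows "cube K b \<subseteq> cube K (parent b)"
proof
  fix x assume "x \<in> cube K b"
  moreover have "width K b \<ge> 0" using assms by (simp add: width_def)
  ultimately show "x \<in> cube K (parent b)"
    unfolding mem_cube_iff width_parent[OF assms(1)] index_parent
    using parent_index_bounds[of "width K b"] by (meson add_left_mono order_trans)
qed

text \<open>
  A common face of two cells belongs to the one with the larger index. The exception made for
  the outer face \<open>x = K / 2\<close> does no harm because no index of a grid box reaches \<open>2 ^ l\<close>: that
  face has no cell of the grid beyond it.
\<close>
lemma grid_box_cell_unique:
  assumes "K > 0" "grid_box a" "grid_box b" "fst a = fst b" "x \<in> cell K a" "x \<in> cell K b"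
  shows "a = b"
proof -
  have no_gap: "k' \<le> k"
    if "- K / 2 + of_int k' * w \<le> t" "k' < 2 ^ l" "w = K / 2 ^ l"
      "t < - K / 2 + (of_int k + 1) * w \<or> t = - K / 2 + (of_int k + 1) * w \<and> t = K / 2"
    for k k' :: int and t w :: real and l
  proof (rule ccontr)
    assume "\<not> k' \<le> k"
    then have le: "(of_int k + 1 :: real) \<le> of_int k'" by linarith
    have w: "w > 0" using that(3) assms(1) by simp
    have "(of_int k + 1) * w \<le> of_int k' * w" using le w by (intro mult_right_mono) auto
    then have "t = - K / 2 + (of_int k + 1) * w" "t = K / 2" using that(1,4) by auto
    then have "(of_int k + 1) * w = K" by linarith
    also have "K = 2 ^ l * w" using that(3) by simp
    finally have "(of_int k + 1) * w = 2 ^ l * w" .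
    then have "of_int (k + 1) = (of_int (2 ^ l) :: real)" using w by simp
    then have "k + 1 = 2 ^ l" by (simp only: of_int_eq_iff)
    then show False using \<open>\<not> k' \<le> k\<close> that(2) by simp
  qed
  have "snd a $ i = snd b $ i" for i
  proof (rule antisym)
    show "snd a $ i \<le> snd b $ i"
      using assms(2,4,5,6) unfolding mem_cell_iff grid_box_def
      by (intro no_gap[of "snd a $ i" "width K b" "x $ i" "fst b"]) (auto simp: width_def)
    show "snd b $ i \<le> snd a $ i"
      using assms(3,4,5,6) unfolding mem_cell_iff grid_box_def
      by (intro no_gap[of "snd b $ i" "width K b" "x $ i" "fst b"]) (auto simp: width_def)
  qed
  then show ?thesis using assms(4) by (simp add: prod_eq_iff vec_eq_iff)
qed

lemma octree_grid_box: "b \<in> octree K q P \<Longrightarrow> grid_box b"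
proof (induction rule: octree.induct)
  case root
  show ?case by (simp add: grid_box_def)
next
  case (child b a)
  show ?case unfolding grid_box_def
  proof
    fix i
    have "snd a $ i div 2 = snd b $ i" using child(4) by (auto simp: parent_def)
    moreover have "0 \<le> snd b $ i" "snd b $ i < 2 ^ fst b" using child(5) by (auto simp: grid_box_def)
    ultimately show "0 \<le> snd a $ i \<and> snd a $ i < 2 ^ fst a" using child(3) by auto
  qed
qed

lemma octree_parent:
  assumes "b \<in> octree K q P" "fst b > 0"
  shows "parent b \<in> octree K q P" "subdivided K q P (parent b)"
  using assms by (cases rule: octree.cases; simp)+

lemma nonempty_boxes_parent:
  assumes "b \<in> nonempty_boxes K q P" "fst b > 0" "K \<ge> 0"
  shows "parent b \<in> nonempty_boxes K q P"
  using assms octree_parent(1)[of b K q P] cell_subset_parent_cell[OF assms(2,3)]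
  by (auto simp: nonempty_boxes_def)

section \<open>Counting boxes that meet a set\<close>

text \<open>
  If two boxes contain points at distance at most one width, their indices differ by at
  most two in each coordinate, which leaves \<open>5 ^ 3\<close> possibilities.
\<close>
lemma boxes_meeting_small_set:
  assumes "K > 0" and D: "\<And>x y. x \<in> D \<Longrightarrow> y \<in> D \<Longrightarrow> dist x y \<le> K / 2 ^ l"
  shows "finite {b. fst b = l \<and> D \<inter> cube K b \<noteq> {}} \<and>
    card {b. fst b = l \<and> D \<inter> cube K b \<noteq> {}} \<le> 125" (is "finite ?Bs \<and> _")
proof (cases "?Bs = {}")
  case False
  then obtain b0 x0 where b0: "fst b0 = l" "x0 \<in> D" "x0 \<in> cube K b0" by blast
  define f :: "box \<Rightarrow> int \<times> int \<times> int" where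
    "f b = (snd b $ 1 - snd b0 $ 1, snd b $ 2 - snd b0 $ 2, snd b $ 3 - snd b0 $ 3)" for b
  have close: "snd b $ i - snd b0 $ i \<in> {-2..2}" if b: "b \<in> ?Bs" for b i
  proof -
    obtain x where x: "fst b = l" "x \<in> D" "x \<in> cube K b" using b by blast
    define w where "w = K / 2 ^ l"
    have w: "w > 0" "width K b = w" "width K b0 = w"
      using assms(1) x(1) b0(1) by (auto simp: w_def width_def)
    have "\<bar>x $ i - x0 $ i\<bar> \<le> w"
      using D[OF x(2) b0(2)] component_le_norm_cart[of "x - x0" i] by (simp add: dist_norm w_def)
    then have "\<bar>(of_int (snd b $ i) - of_int (snd b0 $ i)) * w\<bar> \<le> 2 * w"
      using x(3) b0(3) w unfolding mem_cube_iff
      by (auto dest!: spec[of _ i] simp: distrib_right left_diff_distrib)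
    then have "\<bar>of_int (snd b $ i) - of_int (snd b0 $ i)\<bar> \<le> (2::real)"
      using w(1) by (simp add: abs_mult)
    then show ?thesis by auto
  qed
  have inj: "inj_on f ?Bs"
    by (auto simp: inj_on_def f_def prod_eq_iff vec_eq_iff forall_3)
  have sub: "f ` ?Bs \<subseteq> {-2..2} \<times> {-2..2} \<times> {-2..2}" 
  proof (rule image_subsetI)
    fix b assume "b \<in> ?Bs"
    from close[OF this] show "f b \<in> {-2..2} \<times> {-2..2} \<times> {-2..2}" by (simp add: f_def)
  qed
  have fin: "finite ({-2..2::int} \<times> {-2..2::int} \<times> {-2..2::int})" by simp
  have "finite ?Bs" by (rule finite_imageD[OF finite_subset[OF sub fin] inj])
  moreover have "card ?Bs \<le> card ({-2..2::int} \<times> {-2..2::int} \<times> {-2..2::int})"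
    using card_inj_on_le[OF inj sub fin] .
  ultimately show ?thesis by (simp add: card_cartesian_product)
next
  case True
  show ?thesis unfolding True by simp
qed

lemma card_boxes_meeting_family:
  assumes "K > 0" "finite \<D>" and \<D>: "\<And>D x y. D \<in> \<D> \<Longrightarrow> x \<in> D \<Longrightarrow> y \<in> D \<Longrightarrow> dist x y \<le> K / 2 ^ l"
    and Bs: "\<And>b. b \<in> Bs \<Longrightarrow> fst b = l \<and> \<Union>\<D> \<inter> cube K b \<noteq> {}"
  shows "finite Bs \<and> card Bs \<le> 125 * card \<D>"
proof -
  define G where "G D = {b. fst b = l \<and> D \<inter> cube K b \<noteq> {}}" for D
  have G: "finite (G D)" "card (G D) \<le> 125" if "D \<in> \<D>" for D
    using boxes_meeting_small_set[OF assms(1) \<D>[OF that]] by (auto simp: G_def)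
  have sub: "Bs \<subseteq> (\<Union>D\<in>\<D>. G D)" using Bs by (force simp: G_def)
  moreover have fin: "finite (\<Union>D\<in>\<D>. G D)" using G assms(2) by blast
  ultimately have "card Bs \<le> card (\<Union>D\<in>\<D>. G D)" by (rule card_mono[rotated])
  also have "\<dots> \<le> (\<Sum>D\<in>\<D>. card (G D))" by (rule card_UN_le[OF assms(2)])
  also have "\<dots> \<le> 125 * card \<D>" using sum_bounded_above[of \<D> "\<lambda>D. card (G D)" 125] G by simp
  finally show ?thesis using sub fin finite_subset by blast
qed

text \<open>
  With covering sets as large as the boxes, the number of boxes is bounded by the covering
  number up to the factor \<open>125\<close>.
\<close>
lemma card_boxes_quadratic_covering:
  assumes "quadratic_covering A M" "K > 0" "K / 2 ^ l \<le> R"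
    and Bs: "\<And>b. b \<in> Bs \<Longrightarrow> fst b = l \<and> M \<inter> cball c R \<inter> cube K b \<noteq> {}"
  shows "finite Bs \<and> real (card Bs) \<le> 125 * A * (R / (K / 2 ^ l))\<^sup>2"
proof -
  have "0 < K / 2 ^ l" using assms(2) by simp
  note cover = quadratic_coveringE[OF assms(1) this assms(3), of c]
  obtain \<D> where \<D>: "finite \<D>" "real (card \<D>) \<le> A * (R / (K / 2 ^ l))\<^sup>2"
    "M \<inter> cball c R \<subseteq> \<Union>\<D>" "\<forall>D\<in>\<D>. \<forall>x\<in>D. \<forall>y\<in>D. dist x y \<le> K / 2 ^ l"
    by (rule cover)
  have "finite Bs \<and> card Bs \<le> 125 * card \<D>"
  proof (rule card_boxes_meeting_family[OF assms(2) \<D>(1)])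
    show "dist x y \<le> K / 2 ^ l" if "D \<in> \<D>" "x \<in> D" "y \<in> D" for D x y
      using \<D>(4) that by blast
    show "fst b = l \<and> \<Union>\<D> \<inter> cube K b \<noteq> {}" if "b \<in> Bs" for b
      using Bs[OF that] \<D>(3) by blast
  qed
  then show ?thesis using \<D>(2) by linarith
qed

section \<open>High-frequency interactions\<close>

text \<open>
  The parent of \<open>b\<close> has width \<open>2 w\<close>, so the near field of the parent reaches to \<open>3 w\<^sup>2\<close> from its
  center; the cube of the parent of \<open>a\<close> adds at most \<open>6 w \<le> 6 w\<^sup>2\<close>.
\<close>
lemma dist_high_list_le:
  assumes a: "a \<in> high_list K q P b" and "K > 0" "fst b > 0" "width K b \<ge> 1" and x: "x \<in> cube K a"
  shows "fst a = fst b" "dist (center K (parent b)) x \<le> 9 * (width K b)\<^sup>2"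
proof -
  define w where "w = width K b"
  have wa: "width K a = w" and near: "parent a \<in> near_field K (parent b)"
    using a by (auto simp: high_list_def w_def)
  show fst: "fst a = fst b" using wa assms(2) by (simp add: width_def w_def)
  obtain y where y: "y \<in> cube K (parent a)"
    "norm (y - center K (parent b)) \<le> 3 * (width K (parent b))\<^sup>2 / 4"
    using near unfolding near_field_def by blast
  have "x \<in> cube K (parent a)" using cube_subset_parent_cube[of a K] x fst assms(2,3) by auto
  then have "dist y x \<le> 6 * w"
    using dist_cube_le[OF y(1)] wa fst assms(3) by (simp add: width_parent)
  moreover have "dist (center K (parent b)) y \<le> 3 * w\<^sup>2"
    using y(2) assms(3) by (simp add: width_parent w_def dist_norm norm_minus_commute power_mult_distrib)
  moreover have "w \<le> w\<^sup>2" using assms(4) by (simp add: w_def self_le_power)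
  ultimately show "dist (center K (parent b)) x \<le> 9 * (width K b)\<^sup>2"
    using dist_triangle[of "center K (parent b)" x y] by (simp add: w_def)
qed

lemma level_ge_of_width_le_sqrt:
  assumes "K = 2 ^ (2 * L)" "width K b \<le> sqrt K"
  shows "L \<le> fst b"
proof -
  have "(2::real) ^ (2 * L) \<le> 2 ^ (L + fst b)"
    using assms by (simp add: width_def power_even_eq power_add divide_le_eq)
  then have "2 * L \<le> L + fst b" by (simp only: power_increasing_iff[of "2::real"])
  then show ?thesis by simp
qed

text \<open>
  At width \<open>w\<close> there are at most \<open>125 A (K / w)\<^sup>2\<close> boxes with lists of at most
  \<open>125 A (9 w\<^sup>2 / w)\<^sup>2\<close> boxes; the powers of \<open>w\<close> cancel, so each of the \<open>L + 1\<close> levels contributes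
  the same bound, with \<open>1125 = 125 \<cdot> 9\<close>.
\<close>
lemma card_high_pairs_le:
  assumes cov: "quadratic_covering A M" and K: "K = 2 ^ (2 * L)" and L: "L > 0"
    and P: "P \<subseteq> M" and M: "M \<subseteq> cball 0 K"
  shows "finite (SIGMA b:high_boxes K q P. high_list K q P b) \<and>
    real (card (SIGMA b:high_boxes K q P. high_list K q P b)) \<le> real (L + 1) * ((1125 * A)\<^sup>2 * K\<^sup>2)"
proof -
  have K0: "K > 0" using K by simp
  define H where "H l = {b \<in> high_boxes K q P. fst b = l}" for l
  have level: "fst b \<in> {L..2 * L}" if "b \<in> high_boxes K q P" for b
  proof -
    have "1 \<le> K / 2 ^ fst b" using that by (auto simp: high_boxes_def width_def)
    then have "(2::real) ^ fst b \<le> 2 ^ (2 * L)" unfolding K by (simp add: field_simps)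
    then have "fst b \<le> 2 * L" by (simp only: power_increasing_iff[of "2::real"])
    moreover have "L \<le> fst b"
      using that by (intro level_ge_of_width_le_sqrt[OF K]) (simp add: high_boxes_def)
    ultimately show ?thesis by simp
  qed
  have per_level: "finite (SIGMA b:H l. high_list K q P b) \<and>
    real (card (SIGMA b:H l. high_list K q P b)) \<le> (1125 * A)\<^sup>2 * K\<^sup>2" if l: "l \<in> {L..2 * L}" for l
  proof (cases "H l = {}")
    case False
    define w where "w = K / 2 ^ l"
    have w: "w > 0" "w \<le> K" using K0 by (auto simp: w_def divide_le_eq)
    have wb: "width K b = w" if "b \<in> H l" for b using that by (simp add: H_def width_def w_def)
    have w1: "w \<ge> 1" using False wb by (fastforce simp: H_def high_boxes_def)
    then have w2: "w \<le> 9 * w\<^sup>2" using self_le_power[of w 2] by auto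
    have H: "finite (H l) \<and> real (card (H l)) \<le> 125 * A * (K / w)\<^sup>2"
      unfolding w_def
    proof (rule card_boxes_quadratic_covering[OF cov K0, where c = 0])
      show "K / 2 ^ l \<le> K" using w(2) by (simp add: w_def)
      fix b assume "b \<in> H l"
      then show "fst b = l \<and> M \<inter> cball 0 K \<inter> cube K b \<noteq> {}"
        using P M cell_subset_cube[of K b]
        by (force simp: H_def high_boxes_def nonempty_boxes_def)
    qed
    have I: "finite (high_list K q P b) \<and> real (card (high_list K q P b)) \<le> 125 * A * (9 * w\<^sup>2 / w)\<^sup>2"
      if b: "b \<in> H l" for b
      unfolding w_def
    proof (rule card_boxes_quadratic_covering[OF cov K0, where c = "center K (parent b)"])
      show "K / 2 ^ l \<le> 9 * (K / 2 ^ l)\<^sup>2" using w2 by (simp add: w_def)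
      fix a assume a: "a \<in> high_list K q P b"
      then obtain x where x: "x \<in> cell K a" "x \<in> P"
        by (auto simp: high_list_def nonempty_boxes_def)
      have fb: "fst b = l" "fst b > 0" "width K b \<ge> 1" using b l L w1 wb[OF b] by (auto simp: H_def)
      have "x \<in> cube K a" using x(1) cell_subset_cube by blast
      then have "fst a = fst b" "dist (center K (parent b)) x \<le> 9 * w\<^sup>2"
        using dist_high_list_le[OF a K0 fb(2,3)] wb[OF b] by auto
      then show "fst a = l \<and> M \<inter> cball (center K (parent b)) (9 * (K / 2 ^ l)\<^sup>2) \<inter> cube K a \<noteq> {}"
        using fb(1) P x(2) \<open>x \<in> cube K a\<close> unfolding w_def by auto
    qed
    have "real (card (SIGMA b:H l. high_list K q P b)) = (\<Sum>b\<in>H l. real (card (high_list K q P b)))"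
      using H I by (simp add: card_SigmaI)
    also have "\<dots> \<le> real (card (H l)) * (125 * A * (9 * w\<^sup>2 / w)\<^sup>2)"
      using sum_bounded_above[of "H l" "\<lambda>b. real (card (high_list K q P b))"] I by simp
    also have "\<dots> \<le> (125 * A * (K / w)\<^sup>2) * (125 * A * (9 * w\<^sup>2 / w)\<^sup>2)"
    proof (rule mult_right_mono)
      show "0 \<le> 125 * A * (9 * w\<^sup>2 / w)\<^sup>2" using False I by (metis all_not_in_conv of_nat_0_le_iff order_trans)
    qed (use H in simp)
    also have "\<dots> = (1125 * A)\<^sup>2 * K\<^sup>2" using w(1) by (simp add: power2_eq_square field_simps)
    finally show ?thesis using H I by (auto intro: finite_SigmaI)
  qed simp
  have sub: "(SIGMA b:high_boxes K q P. high_list K q P b) \<subseteq>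
      (\<Union>l\<in>{L..2 * L}. SIGMA b:H l. high_list K q P b)" (is "?X \<subseteq> ?Y")
    using level by (auto simp: H_def)
  have fin: "finite ?Y" using per_level by blast
  have "card ?X \<le> card ?Y" by (rule card_mono[OF fin sub])
  also have "\<dots> \<le> (\<Sum>l\<in>{L..2 * L}. card (SIGMA b:H l. high_list K q P b))"
    by (rule card_UN_le) simp
  finally have "real (card ?X) \<le> (\<Sum>l\<in>{L..2 * L}. real (card (SIGMA b:H l. high_list K q P b)))"
    by (simp flip: of_nat_sum)
  also have "\<dots> \<le> real (card {L..2 * L}) * ((1125 * A)\<^sup>2 * K\<^sup>2)"
    using per_level by (intro sum_bounded_above) auto
  finally show ?thesis using finite_subset[OF sub fin] by simp
qed

section \<open>Low-frequency boxes\<close>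

text \<open>
  A low-frequency box whose parent also has width below one arises because the parent
  contains two samples. These are at distance at most three parent widths, which contradicts
  their separation once the parent is small. The constant \<open>3\<close> in the bound on the level
  absorbs this factor \<open>3 < 2 ^ 3\<close>.
\<close>
lemma low_box_level_le:
  assumes K: "K = 2 ^ (2 * L)" and "q \<ge> 1" "finite P"
    and sep: "\<And>x y. x \<in> P \<Longrightarrow> y \<in> P \<Longrightarrow> x \<noteq> y \<Longrightarrow> 1 \<le> 2 ^ n * K * dist x y"
    and b: "b \<in> low_boxes K q P"
  shows "fst b \<le> n + 4 * L + 3"
proof (rule ccontr)
  assume high: "\<not> fst b \<le> n + 4 * L + 3"
  define l where "l = fst b - 1"
  have l: "fst b = Suc l" "l \<ge> n + 4 * L + 3" using high by (auto simp: l_def)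
  have wp: "width K (parent b) = 2 ^ (2 * L) / 2 ^ l" using l(1) K by (simp add: width_def parent_def)
  have "(2::real) ^ (2 * L) < 2 ^ l" using l(2) by (intro power_strict_increasing) auto
  then have "width K (parent b) < 1" unfolding wp by simp
  moreover have "subdivided K q P (parent b)"
    using b l(1) octree_parent(2) by (auto simp: low_boxes_def nonempty_boxes_def)
  ultimately have "\<not> card (cell K (parent b) \<inter> P) \<le> Suc 0" using \<open>q \<ge> 1\<close> by (simp add: subdivided_def)
  then obtain x y where xy: "x \<in> P" "y \<in> P" "x \<noteq> y" "x \<in> cell K (parent b)" "y \<in> cell K (parent b)"
    using card_le_Suc0_iff_eq[of "cell K (parent b) \<inter> P"] \<open>finite P\<close> by auto
  then have "dist x y \<le> 3 * (2 ^ (2 * L) / 2 ^ l)"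
    using dist_cube_le cell_subset_cube unfolding wp[symmetric] by blast
  then have "2 ^ n * K * dist x y \<le> 2 ^ n * K * (3 * (2 ^ (2 * L) / 2 ^ l))"
    unfolding K by (intro mult_left_mono) auto
  also have "\<dots> = 3 * 2 ^ (n + 4 * L) / 2 ^ l" unfolding K
  proof -
    have "(2::real) ^ (4 * L) = 2 ^ (2 * L) * 2 ^ (2 * L)" by (simp flip: power_add)
    then show "2 ^ n * 2 ^ (2 * L) * (3 * (2 ^ (2 * L) / 2 ^ l)) = 3 * 2 ^ (n + 4 * L) / (2::real) ^ l"
      by (simp only: power_add) simp
  qed
  also have "\<dots> < 2 ^ (n + 4 * L + 3) / 2 ^ l"
    by (intro divide_strict_right_mono) (auto simp: power_add)
  also have "\<dots> \<le> 1" using l(2) by (simp add: power_increasing)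
  finally show False using sep[OF xy(1-3)] by simp
qed

text \<open>
  On each level every nonempty box contains a sample and every sample lies in boundedly many
  closed cubes, so \<open>O(N)\<close> boxes occur on each of \<open>O(L)\<close> levels.
\<close>
lemma card_low_boxes_le:
  assumes K: "K = 2 ^ (2 * L)" and L: "L > 0" and "q \<ge> 1" "finite P"
    and sep: "\<And>x y. x \<in> P \<Longrightarrow> y \<in> P \<Longrightarrow> x \<noteq> y \<Longrightarrow> 1 \<le> 2 ^ n * K * dist x y"
  shows "finite (low_boxes K q P) \<and> card (low_boxes K q P) \<le> (n + 8) * L * (125 * card P)"
proof -
  define B where "B l = {b \<in> low_boxes K q P. fst b = l}" for l
  let ?singles = "(\<lambda>p. {p}) ` P"
  have B: "finite (B l) \<and> card (B l) \<le> 125 * card P" for l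
  proof -
    have "finite (B l) \<and> card (B l) \<le> 125 * card ?singles"
    proof (rule card_boxes_meeting_family[where K = K and l = l])
      fix b assume "b \<in> B l"
      then show "fst b = l \<and> \<Union>?singles \<inter> cube K b \<noteq> {}"
        using cell_subset_cube[of K b] by (auto simp: B_def low_boxes_def nonempty_boxes_def)
    qed (use K \<open>finite P\<close> in auto)
    then show ?thesis using card_image_le[OF \<open>finite P\<close>, of "\<lambda>p. {p}"] by linarith
  qed
  have sub: "low_boxes K q P \<subseteq> (\<Union>l\<in>{..n + 4 * L + 3}. B l)"
    using low_box_level_le[OF K assms(3,4) sep] by (auto simp: B_def)
  have fin: "finite (\<Union>l\<in>{..n + 4 * L + 3}. B l)" using B by blast
  have "card (low_boxes K q P) \<le> card (\<Union>l\<in>{..n + 4 * L + 3}. B l)" by (rule card_mono[OF fin sub])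
  also have "\<dots> \<le> (\<Sum>l\<in>{..n + 4 * L + 3}. card (B l))" by (rule card_UN_le) simp
  also have "\<dots> \<le> card {..n + 4 * L + 3} * (125 * card P)"
    using sum_bounded_above[of "{..n + 4 * L + 3}" "\<lambda>l. card (B l)"] B by simp
  also have "\<dots> \<le> (n + 8) * L * (125 * card P)"
  proof (rule mult_right_mono)
    have "n * 1 + 4 * 1 \<le> n * L + 4 * L" using L by (intro add_mono mult_le_mono) auto
    then show "card {..n + 4 * L + 3} \<le> (n + 8) * L" by (simp add: distrib_right)
  qed simp
  finally show ?thesis using finite_subset[OF sub fin] by blast
qed

section \<open>A single sample\<close>

text \<open>
  With one sample there is at most one nonempty box per level, so all of width at most \<open>\<surd>K\<close>
  descend from the same box of width \<open>\<surd>K\<close> and inherit its process.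
\<close>
lemma single_point_same_process:
  assumes K: "K = 2 ^ (2 * L)" and P: "P = {x}" and proc: "process_map K q P np proc"
    and "a \<in> nonempty_boxes K q P" "b \<in> nonempty_boxes K q P" "fst a \<ge> L" "fst b \<ge> L"
  shows "proc a = proc b"
proof -
  have K0: "K > 0" using K by simp
  have unique: "a = b" if "a \<in> nonempty_boxes K q P" "b \<in> nonempty_boxes K q P" "fst a = fst b" for a b
  proof (rule grid_box_cell_unique[OF K0])
    show "grid_box a" "grid_box b" using that(1,2) unfolding nonempty_boxes_def
      by (metis (no_types, lifting) mem_Collect_eq octree_grid_box)+
    show "x \<in> cell K a" "x \<in> cell K b" using that(1,2) P by (auto simp: nonempty_boxes_def)
  qed (rule that(3))
  have step: "parent b \<in> nonempty_boxes K q P \<and> proc b = proc (parent b) \<and> fst (parent b) = l"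
    if "b \<in> nonempty_boxes K q P" "fst b = Suc l" "l \<ge> L" for b l
  proof -
    have "width K b = 2 ^ (2 * L) / 2 ^ Suc l" using that K by (simp add: width_def)
    also have "\<dots> < 2 ^ (2 * L) / 2 ^ L"
      using that(3) by (intro divide_strict_left_mono power_strict_increasing) auto
    also have "\<dots> = sqrt K"
      unfolding K by (simp add: power_even_eq power2_eq_square)
    finally show ?thesis using proc that nonempty_boxes_parent[of b K q P] K0
      by (auto simp: process_map_def parent_def)
  qed
  have reach: "\<exists>r. r \<in> nonempty_boxes K q P \<and> fst r = L \<and> proc b = proc r"
    if "b \<in> nonempty_boxes K q P" "fst b = L + k" for b k
    using that
  proof (induction k arbitrary: b)
    case (Suc k)
    then show ?case using step[of b "L + k"] by (metis add_Suc_right le_add1)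
  qed auto
  show ?thesis
    using reach[OF assms(4), of "fst a - L"] reach[OF assms(5), of "fst b - L"] assms(6,7) unique by force
qed

section \<open>The data sent in aggregate\<close>

text \<open>
  Every pair in an interaction list is charged, even if no message is needed because both
  boxes belong to one process; the bound is therefore uniform in the partition.
\<close>
lemma data_sent_le:
  assumes dir: "direction_assignment K q P dirs wedge dir"
    and low: "low_interaction_lists m K q P low_list"
    and len: "densities_bounded n K q P dirs f_high f_low"
    and fin: "finite (SIGMA b:high_boxes K q P. high_list K q P b)" "finite (low_boxes K q P)"
  shows "finite (high_messages K q P proc)" "finite (low_messages K q P proc low_list)"
    "data_sent K q P proc dir low_list f_high f_low \<le>
      n * (card (SIGMA b:high_boxes K q P. high_list K q P b) + m * card (low_boxes K q P))"
proof -
  let ?H = "SIGMA b:high_boxes K q P. high_list K q P b"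
  let ?L = "SIGMA b:low_boxes K q P. low_list b"
  have subH: "high_messages K q P proc \<subseteq> ?H" by (auto simp: high_messages_def)
  have subL: "low_messages K q P proc low_list \<subseteq> ?L" by (auto simp: low_messages_def)
  have low': "low_list b \<subseteq> low_boxes K q P" "finite (low_list b)" "card (low_list b) \<le> m"
    if "b \<in> low_boxes K q P" for b using low that unfolding low_interaction_lists_def by blast+
  have finL: "finite ?L" using fin(2) low'(2) by (intro finite_SigmaI) auto
  show finH': "finite (high_messages K q P proc)" using finite_subset[OF subH fin(1)] .
  show finL': "finite (low_messages K q P proc low_list)" using finite_subset[OF subL finL] .
  have "length (f_high a (dir a b)) \<le> n" if "b \<in> high_boxes K q P" "a \<in> high_list K q P b" for a b
  proof -
    have "a \<in> high_boxes K q P" using that by (auto simp: high_list_def high_boxes_def)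
    moreover have "dir a b \<in> dirs a" using dir that unfolding direction_assignment_def by blast
    ultimately show ?thesis using len unfolding densities_bounded_def by blast
  qed
  then have "(\<Sum>(b, a)\<in>high_messages K q P proc. length (f_high a (dir a b))) \<le>
      card (high_messages K q P proc) * n"
    using sum_bounded_above[of "high_messages K q P proc" "\<lambda>(b, a). length (f_high a (dir a b))" n]
    by (auto simp: high_messages_def)
  also have "\<dots> \<le> card ?H * n" using card_mono[OF fin(1) subH] by simp
  finally have high_sum: "(\<Sum>(b, a)\<in>high_messages K q P proc. length (f_high a (dir a b))) \<le> card ?H * n" .
  have "length (f_low a) \<le> n" if "b \<in> low_boxes K q P" "a \<in> low_list b" for a b
    using low'(1)[OF that(1)] that(2) len unfolding densities_bounded_def by blast
  then have "(\<Sum>(b, a)\<in>low_messages K q P proc low_list. length (f_low a)) \<le>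
      card (low_messages K q P proc low_list) * n"
    using sum_bounded_above[of "low_messages K q P proc low_list" "\<lambda>(b, a). length (f_low a)" n]
    by (auto simp: low_messages_def)
  also have "\<dots> \<le> card ?L * n" using card_mono[OF finL subL] by simp
  also have "card ?L = (\<Sum>b\<in>low_boxes K q P. card (low_list b))"
    using fin(2) low'(2) by (intro card_SigmaI) auto
  also have "\<dots> \<le> card (low_boxes K q P) * m"
    using sum_bounded_above[of "low_boxes K q P" "\<lambda>b. card (low_list b)" m] low'(3) by simp
  finally have "(\<Sum>(b, a)\<in>low_messages K q P proc low_list. length (f_low a)) \<le>
      card (low_boxes K q P) * m * n" by simp
  with high_sum show "data_sent K q P proc dir low_list f_high f_low \<le>
      n * (card ?H + m * card (low_boxes K q P))"
    unfolding data_sent_def by (simp add: algebra_simps)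
qed

text \<open>
  From \<open>N \<ge> c K\<^sup>2\<close> follows \<open>ln N \<ge> ln c + 2 ln K\<close>. For small \<open>c\<close> the negative term \<open>ln c\<close> is absorbed
  into a multiple of \<open>ln N \<ge> ln 2\<close>.
\<close>
lemma ln_le_of_quadratic_le:
  fixes c K :: real and N :: nat
  assumes "c > 0" "K \<ge> 1" "N \<ge> 2" "c * K\<^sup>2 \<le> N"
  shows "ln K \<le> (1 + \<bar>ln c\<bar> / ln 2) * ln N"
proof -
  have lnN: "ln 2 \<le> ln (real N)" using assms(3) by simp
  have ln2: "ln (2::real) > 0" by simp
  have "ln (c * K\<^sup>2) \<le> ln (real N)" using assms by (subst ln_le_cancel_iff) auto
  moreover have "ln (c * K\<^sup>2) = ln c + 2 * ln K" using assms(1,2) by (simp add: ln_mult ln_realpow)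
  moreover have "ln K \<ge> 0" using assms(2) by simp
  ultimately have "ln K \<le> ln (real N) + \<bar>ln c\<bar>" by linarith
  also have "\<bar>ln c\<bar> \<le> \<bar>ln c\<bar> / ln 2 * ln (real N)"
    using mult_left_mono[OF lnN, of "\<bar>ln c\<bar> / ln 2"] ln2 by simp
  finally show ?thesis by (simp add: distrib_right)
qed

theorem proposition3p1:
  fixes S :: "(real^3) set"
    and \<epsilon> cqu c1 c2 cdir cang :: real
    and q m :: nat
    and len :: "real \<Rightarrow> nat"
  assumes "surface S" and "S \<subseteq> cball 0 (1/2)"
    and "\<epsilon> > 0" and "c1 > 0" and "q \<ge> 1"
  shows "\<exists>C::real. \<forall>(L::nat) (K::real) (N::nat) (P::(real^3) set) (np::nat) (proc::box \<Rightarrow> nat)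
      (dirs::box \<Rightarrow> nat set) (wedge::box \<Rightarrow> nat \<Rightarrow> (real^3) set) (dir::box \<Rightarrow> box \<Rightarrow> nat)
      (low_list::box \<Rightarrow> box set) (f_high::box \<Rightarrow> nat \<Rightarrow> complex list) (f_low::box \<Rightarrow> complex list).
      L > 0 \<and> K = 2 ^ (2 * L) \<and>
      quasi_uniform cqu P ((\<lambda>x. K *\<^sub>R x) ` S) \<and>
      N = card P \<and> c1 * K\<^sup>2 \<le> real N \<and> real N \<le> c2 * K\<^sup>2 \<and>
      process_map K q P np proc \<and>
      (\<forall>b\<in>high_boxes K q P. wedge_partition cdir cang K b (dirs b) (wedge b)) \<and>
      direction_assignment K q P dirs wedge dir \<and>
      low_interaction_lists m K q P low_list \<and>
      densities_bounded (len \<epsilon>) K q P dirs f_high f_low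
      \<longrightarrow>
      finite (high_messages K q P proc) \<and> finite (low_messages K q P proc low_list) \<and>
      real (data_sent K q P proc dir low_list f_high f_low) \<le> C * (K\<^sup>2 * ln K) \<and>
      real (data_sent K q P proc dir low_list f_high f_low) \<le> C * (real N * ln (real N))"
proof (cases "S = {}")
  case True
  then show ?thesis by (auto simp: quasi_uniform_def)
next
  case False
  obtain A where A: "quadratic_covering A S" using surface_quadratic_covering[OF assms(1)] by blast
  obtain T a b where T: "T \<subseteq> S" "connected T" "a \<in> T" "b \<in> T" "a \<noteq> b"
    using surface_contains_nontrivial_connected[OF assms(1) False] by blast
  have bnd: "bounded S" using assms(1) by (auto simp: surface_def compact_imp_bounded)
  obtain n where n: "2 * max cqu 0 * max c2 0 / dist a b \<le> 2 ^ n"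
    using real_arch_pow[of 2 "2 * max cqu 0 * max c2 0 / dist a b"] by (auto intro: less_imp_le)
  \<comment> \<open>\<open>C1\<close> bounds the data by \<open>K\<^sup>2 L\<close>; \<open>max\<close> covers negative constants \<open>cqu\<close> and \<open>c2\<close>.\<close>
  define C1 where "C1 = real (len \<epsilon>) * (2 * (1125 * A)\<^sup>2 + real m * (real (n + 8) * 125 * max c2 0))"
  define g where "g = 1 + \<bar>ln c1\<bar> / ln 2"
  have C1: "C1 \<ge> 0" unfolding C1_def by (intro mult_nonneg_nonneg add_nonneg_nonneg) auto
  have g: "g \<ge> 0" by (simp add: g_def)
  \<comment> \<open>The second summand pays for the passage from \<open>K\<^sup>2 ln K\<close> to \<open>N ln N\<close>.\<close>
  define C where "C = C1 + C1 * g / c1"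
  have C: "C1 \<le> C" "C1 * g / c1 \<le> C" "0 \<le> C" using C1 g \<open>c1 > 0\<close> by (simp_all add: C_def)
  show ?thesis
  proof (intro exI[of _ C] allI impI)
    fix L :: nat and K :: real and N :: nat and P :: "(real^3) set" and np :: nat
      and proc :: "box \<Rightarrow> nat" and dirs :: "box \<Rightarrow> nat set" and wedge :: "box \<Rightarrow> nat \<Rightarrow> (real^3) set"
      and dir :: "box \<Rightarrow> box \<Rightarrow> nat" and low_list :: "box \<Rightarrow> box set"
      and f_high :: "box \<Rightarrow> nat \<Rightarrow> complex list" and f_low :: "box \<Rightarrow> complex list"
    let ?M = "(\<lambda>x. K *\<^sub>R x) ` S"
    let ?data = "real (data_sent K q P proc dir low_list f_high f_low)"
    let ?H = "SIGMA b:high_boxes K q P. high_list K q P b"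
    assume "L > 0 \<and> K = 2 ^ (2 * L) \<and>
      quasi_uniform cqu P ?M \<and>
      N = card P \<and> c1 * K\<^sup>2 \<le> real N \<and> real N \<le> c2 * K\<^sup>2 \<and>
      process_map K q P np proc \<and>
      (\<forall>b\<in>high_boxes K q P. wedge_partition cdir cang K b (dirs b) (wedge b)) \<and>
      direction_assignment K q P dirs wedge dir \<and>
      low_interaction_lists m K q P low_list \<and>
      densities_bounded (len \<epsilon>) K q P dirs f_high f_low"
    then have L: "L > 0" and K: "K = 2 ^ (2 * L)" and qu: "quasi_uniform cqu P ?M"
      and N: "N = card P" and N1: "c1 * K\<^sup>2 \<le> real N" and N2: "real N \<le> c2 * K\<^sup>2"
      and proc: "process_map K q P np proc"
      and dir: "direction_assignment K q P dirs wedge dir"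
      and low: "low_interaction_lists m K q P low_list"
      and len: "densities_bounded (len \<epsilon>) K q P dirs f_high f_low" by blast+
    have K0: "K > 0" "K \<ge> 1" using K by simp_all
    have P: "finite P" "P \<noteq> {}" "P \<subseteq> ?M" using qu by (auto simp: quasi_uniform_def)
    have "norm (K *\<^sub>R x) \<le> K" if "x \<in> S" for x
    proof -
      have "norm x \<le> 1" using that assms(2) by fastforce
      then show ?thesis using K0 by (simp add: mult_left_le)
    qed
    then have M: "?M \<subseteq> cball 0 K" by auto
    have high_pairs: "finite ?H" "real (card ?H) \<le> real (L + 1) * ((1125 * A)\<^sup>2 * K\<^sup>2)"
      using card_high_pairs_le[OF quadratic_covering_scaleR[OF A K0(1)] K L P(3) M] by blast+
    have sep: "1 \<le> 2 ^ n * K * dist x y" if "x \<in> P" "y \<in> P" "x \<noteq> y" for x y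
      using point_separation[OF K0(1) T bnd qu N2[unfolded N] n that] .
    have low_count: "finite (low_boxes K q P)"
      "card (low_boxes K q P) \<le> (n + 8) * L * (125 * card P)"
      using card_low_boxes_le[OF K L \<open>q \<ge> 1\<close> P(1) sep] by blast+
    note sent = data_sent_le[OF dir low len high_pairs(1) low_count(1)]
    have "real (card (low_boxes K q P)) \<le> real ((n + 8) * L * (125 * card P))"
      using low_count(2) by (simp only: of_nat_le_iff)
    also have "\<dots> = real (n + 8) * 125 * (real L * real N)" using N by simp
    also have "\<dots> \<le> real (n + 8) * 125 * (real L * (max c2 0 * K\<^sup>2))"
    proof (intro mult_left_mono)
      have "c2 * K\<^sup>2 \<le> max c2 0 * K\<^sup>2" by (rule mult_right_mono) auto
      then show "real N \<le> max c2 0 * K\<^sup>2" using N2 by linarith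
    qed auto
    finally have low_real: "real (card (low_boxes K q P)) \<le>
      real (n + 8) * 125 * (real L * (max c2 0 * K\<^sup>2))" .
    have "real (L + 1) \<le> 2 * real L" using L by simp
    then have "real (L + 1) * ((1125 * A)\<^sup>2 * K\<^sup>2) \<le> 2 * real L * ((1125 * A)\<^sup>2 * K\<^sup>2)"
      by (rule mult_right_mono) simp
    then have high_real: "real (card ?H) \<le> 2 * real L * ((1125 * A)\<^sup>2 * K\<^sup>2)"
      using high_pairs(2) by linarith
    have "?data \<le> real (len \<epsilon> * (card ?H + m * card (low_boxes K q P)))"
      using sent(3) by (simp only: of_nat_le_iff)
    also have "\<dots> = real (len \<epsilon>) * (real (card ?H) + real m * real (card (low_boxes K q P)))"
      by simp
    also have "\<dots> \<le> real (len \<epsilon>) * (2 * real L * ((1125 * A)\<^sup>2 * K\<^sup>2) +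
        real m * (real (n + 8) * 125 * (real L * (max c2 0 * K\<^sup>2))))"
      by (intro mult_left_mono add_mono high_real low_real) auto
    also have "\<dots> = C1 * K\<^sup>2 * real L" by (simp add: C1_def algebra_simps)
    also have "\<dots> \<le> C1 * K\<^sup>2 * ln K"
    proof (rule mult_left_mono)
      have "ln K = real L * (2 * ln 2)" unfolding K by (simp add: ln_realpow)
      moreover have "real L * 1 \<le> real L * (2 * ln 2)"
        using ln2_ge_two_thirds by (intro mult_left_mono) auto
      ultimately show "real L \<le> ln K" by simp
    qed (use C1 in simp)
    finally have data: "?data \<le> C1 * (K\<^sup>2 * ln K)" by (simp add: mult.assoc)
    have KlnK: "0 \<le> K\<^sup>2 * ln K" using K0(2) by simp
    have boundK: "?data \<le> C * (K\<^sup>2 * ln K)" using data mult_right_mono[OF C(1) KlnK] by linarith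
    have boundN: "?data \<le> C * (real N * ln (real N))"
    proof (cases "N = 1")
      case True
      \<comment> \<open>The bound is zero here, so it has to be shown that no message is sent.\<close>
      from True obtain x where x: "P = {x}" using N by (auto simp: card_1_singleton_iff)
      have sqrtK: "1 \<le> sqrt K" using K0(2) by simp
      have same: "proc a = proc b"
        if "a \<in> high_boxes K q P \<union> low_boxes K q P" "b \<in> high_boxes K q P \<union> low_boxes K q P" for a b
      proof (rule single_point_same_process[OF K x proc])
        show "a \<in> nonempty_boxes K q P" "b \<in> nonempty_boxes K q P"
          using that by (auto simp: high_boxes_def low_boxes_def)
        have "width K b \<le> sqrt K" if "b \<in> high_boxes K q P \<union> low_boxes K q P" for b
          using that order_trans[OF less_imp_le sqrtK] by (auto simp: high_boxes_def low_boxes_def)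
        then show "L \<le> fst a" "L \<le> fst b"
          using that level_ge_of_width_le_sqrt[OF K] by blast+
      qed
      have "a \<in> high_boxes K q P" if "b \<in> high_boxes K q P" "a \<in> high_list K q P b" for a b
        using that by (auto simp: high_list_def high_boxes_def)
      then have "high_messages K q P proc = {}" using same unfolding high_messages_def by blast
      moreover have "a \<in> low_boxes K q P" if "b \<in> low_boxes K q P" "a \<in> low_list b" for a b
        using that low unfolding low_interaction_lists_def by blast
      then have "low_messages K q P proc low_list = {}" using same unfolding low_messages_def by blast
      ultimately have "data_sent K q P proc dir low_list f_high f_low = 0" by (simp add: data_sent_def)
      then show ?thesis using True by simp
    next
      case False
      moreover have "N \<noteq> 0" using N P by simp
      ultimately have "N \<ge> 2" by linarith
      have "K\<^sup>2 \<le> real N / c1" using N1 \<open>c1 > 0\<close> by (simp add: pos_le_divide_eq mult.commute)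
      moreover have "ln K \<le> g * ln (real N)"
        unfolding g_def by (rule ln_le_of_quadratic_le[OF \<open>c1 > 0\<close> K0(2) \<open>N \<ge> 2\<close> N1])
      ultimately have "K\<^sup>2 * ln K \<le> real N / c1 * (g * ln (real N))"
        using K0(2) \<open>c1 > 0\<close> by (intro mult_mono) auto
      then have "C1 * (K\<^sup>2 * ln K) \<le> C1 * (real N / c1 * (g * ln (real N)))"
        using C1 by (rule mult_left_mono)
      also have "\<dots> = C1 * g / c1 * (real N * ln (real N))" by simp
      also have "\<dots> \<le> C * (real N * ln (real N))"
        using C(2) \<open>N \<ge> 2\<close> by (intro mult_right_mono) auto
      finally show ?thesis using data by linarith
    qed
    show "finite (high_messages K q P proc) \<and> finite (low_messages K q P proc low_list) \<and>
      ?data \<le> C * (K\<^sup>2 * ln K) \<and> ?data \<le> C * (real N * ln (real N))"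
      using sent(1,2) boundK boundN by blast
  qed
qed

end
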